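(* Let $b$ be a prime, $m\in\mathbb{N}$, $N=b^m$, $s\in\mathbb{N}$, $\alpha>1$. Let $(\gamma_j)_{j\ge1}$ be a non-increasing sequence of positive reals and let $\gamma_{\mathfrak{u}}=\prod_{j\in\mathfrak{u}}\gamma_j$ be the corresponding product weights. Let $0\le w_1\le w_2\le\cdots$ be integers and $Y_j=b^{w_j}$. Let $\boldsymbol{z}=(Y_1z_1,\ldots,Y_sz_s)$ be constructed by the reduced successive coordinate search (SCS) algorithm (defined in the context) from some initial vector $\boldsymbol{z}^0\in\{0,1,\ldots,N-1\}^s$. Then for all $\delta\in(0,\frac{\alpha-1}{2}]$, $$e_{N,s}(\boldsymbol{z})\le C_{s,\alpha,\boldsymbol{\gamma},\delta}\,N^{-\alpha/2+\delta},$$ where $$C_{s,\alpha,\boldsymbol{\gamma},\delta}:=\left(\left(\sum_{d=1}^s\gamma_d^{\frac{1}{\alpha-2\delta}}b^{w_d}\right)\left(4\zeta\left(\tfrac{\alpha}{\alpha-2\delta}\right)\right)\prod_{d=1}^{s-1}\left(1+\gamma_d^{\frac{1}{\alpha-2\delta}}\,2\zeta\left(\tfrac{\alpha}{\alpha-2\delta}\right)\right)\right)^{\alpha/2-\delta}.$$ Furthermore, the constant $C_{s,\alpha,\boldsymbol{\gamma},\delta}$ is bounded independently of the dimension $s$ if $$\sum_{d=1}^\infty\gamma_d^{\frac{1}{\alpha-2\delta}}\,b^{w_d}<\infty.$$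
   Context: Notation: $[s]=\{1,\ldots,s\}$, $\mathbb{Z}_*=\mathbb{Z}\setminus\{0\}$; for a vector $\boldsymbol{x}$ and $\mathfrak{u}\subseteq[s]$, $\boldsymbol{x}_{\mathfrak{u}}=(x_j)_{j\in\mathfrak{u}}$; $\{\cdot\}$ is the fractional part, applied componentwise; $\zeta$ is the Riemann zeta function. Weighted Korobov space: $\mathcal{H}(K_{s,\alpha,\boldsymbol{\gamma}})$ is the reproducing kernel Hilbert space of functions on $[0,1]^s$ with kernel $$K_{s,\alpha,\boldsymbol{\gamma}}(\boldsymbol{x},\boldsymbol{y})=1+\sum_{\emptyset\ne\mathfrak{u}\subseteq[s]}\gamma_{\mathfrak{u}}\sum_{\boldsymbol{h}_{\mathfrak{u}}\in\mathbb{Z}_*^{|\mathfrak{u}|}}\frac{\exp(2\pi \mathrm{i}\,\boldsymbol{h}_{\mathfrak{u}}\cdot(\boldsymbol{x}_{\mathfrak{u}}-\boldsymbol{y}_{\mathfrak{u}}))}{\prod_{j\in\mathfrak{u}}|h_j|^\alpha}.$$ Worst-case error: for $\boldsymbol{\xi}\in\mathbb{Z}^s$, $e_{N,s}(\boldsymbol{\xi})$ is the supremum of $\left|\int_{[0,1]^s}f(\boldsymbol{x})\,\mathrm{d}\boldsymbol{x}-\frac1N\sum_{n=0}^{N-1}f(\{n\boldsymbol{\xi}/N\})\right|$ over all $f$ in the unit ball of $\mathcal{H}(K_{s,\alpha,\boldsymbol{\gamma}})$. It is known that $$e_{N,s}^2(\boldsymbol{\xi})=\sum_{\emptyset\ne\mathfrak{u}\subseteq[s]}\gamma_{\mathfrak{u}}\sum_{\boldsymbol{h}_{\mathfrak{u}}\in\mathcal{D}_{\mathfrak{u}}(\boldsymbol{\xi}_{\mathfrak{u}})}\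 \prod_{j\in\mathfrak{u}}|h_j|^{-\alpha},\qquad \mathcal{D}_{\mathfrak{u}}(\boldsymbol{\xi}_{\mathfrak{u}})=\{\boldsymbol{h}_{\mathfrak{u}}\in\mathbb{Z}_*^{|\mathfrak{u}|}:\boldsymbol{h}_{\mathfrak{u}}\cdot\boldsymbol{\xi}_{\mathfrak{u}}\equiv0\ (\mathrm{mod}\ N)\}.$$ Search spaces: $\mathcal{Z}_{N,w_j}=\{z\in\{1,2,\ldots,b^{m-w_j}-1\}:\gcd(z,N)=1\}$ if $w_j<m$, and $\mathcal{Z}_{N,w_j}=\{1\}$ if $w_j\ge m$. Reduced SCS algorithm: given $\boldsymbol{z}^0=(z_1^0,\ldots,z_s^0)$, for $d=1,2,\ldots,s$ successively, with $z_1,\ldots,z_{d-1}$ already selected, choose $z_d\in\mathcal{Z}_{N,w_d}$ such that $e_{N,s}^2((Y_1z_1,\ldots,Y_{d-1}z_{d-1},Y_dz_d,z_{d+1}^0,\ldots,z_s^0))$ is minimized as a function of $z_d$ over $\mathcal{Z}_{N,w_d}$. The output is $\boldsymbol{z}=(Y_1z_1,\ldots,Y_sz_s)$. *)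

theory Defs
  imports "HOL-Analysis.Analysis" "HOL-Computational_Algebra.Primes"
begin

text \<open>
  Vectors with components indexed by \<open>[s] = {1..s}\<close> are elements of \<open>{1..s} \<rightarrow>\<^sub>E A\<close>, and
  likewise for components indexed by a subset of \<open>[s]\<close>.
\<close>

section \<open>Reproducing kernel Hilbert spaces\<close>

text \<open>
  A complex Hilbert space of functions on \<open>X\<close>, given by its carrier \<open>H\<close> and its inner product \<open>ip\<close>
  (linear in the first argument). HOL functions are total, so a function on \<open>X\<close> is represented by
  its extension by \<open>0\<close>; this makes \<open>H\<close> a set of functions with pointwise operations in which
  equality means equality on \<open>X\<close>.
\<close>

definition ip_norm :: "(('a \<Rightarrow> complex) \<Rightarrow> ('a \<Rightarrow> complex) \<Rightarrow> complex) \<Rightarrow> ('a \<Rightarrow> complex) \<Rightarrow> real" where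
  "ip_norm ip f = sqrt (Re (ip f f))"

locale hilbert_function_space =
  fixes X :: "'a set"
    and H :: "('a \<Rightarrow> complex) set"
    and ip :: "('a \<Rightarrow> complex) \<Rightarrow> ('a \<Rightarrow> complex) \<Rightarrow> complex"
  assumes supp: "f \<in> H \<Longrightarrow> x \<notin> X \<Longrightarrow> f x = 0"
    and zero_mem: "(\<lambda>x. 0) \<in> H"
    and add_mem: "f \<in> H \<Longrightarrow> g \<in> H \<Longrightarrow> (\<lambda>x. f x + g x) \<in> H"
    and scale_mem: "f \<in> H \<Longrightarrow> (\<lambda>x. c * f x) \<in> H"
    and ip_add: "f \<in> H \<Longrightarrow> g \<in> H \<Longrightarrow> k \<in> H \<Longrightarrow> ip (\<lambda>x. f x + g x) k = ip f k + ip g k"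
    and ip_scale: "f \<in> H \<Longrightarrow> g \<in> H \<Longrightarrow> ip (\<lambda>x. c * f x) g = c * ip f g"
    and ip_cnj: "f \<in> H \<Longrightarrow> g \<in> H \<Longrightarrow> ip g f = cnj (ip f g)"
    and ip_pos: "f \<in> H \<Longrightarrow> f \<noteq> (\<lambda>x. 0) \<Longrightarrow> Re (ip f f) > 0"
    and complete: "(\<And>n. F n \<in> H) \<Longrightarrow>
      (\<And>\<epsilon>. \<epsilon> > 0 \<Longrightarrow> \<exists>n0. \<forall>p\<ge>n0. \<forall>q\<ge>n0. ip_norm ip (\<lambda>x. F p x - F q x) < \<epsilon>) \<Longrightarrow>
      \<exists>f\<in>H. (\<lambda>n. ip_norm ip (\<lambda>x. F n x - f x)) \<longlonglongrightarrow> 0"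

definition kernel_section :: "'a set \<Rightarrow> ('a \<Rightarrow> 'a \<Rightarrow> complex) \<Rightarrow> 'a \<Rightarrow> 'a \<Rightarrow> complex" where
  "kernel_section X K y = (\<lambda>x. if x \<in> X then K x y else 0)"

text \<open>
  By the Moore-Aronszajn theorem, a positive definite kernel \<open>K\<close> determines the pair of \<open>H\<close> and
  \<open>ip\<close> (on \<open>H\<close>) uniquely.
\<close>

locale rkhs = hilbert_function_space X H ip
  for X :: "'a set"
    and K :: "'a \<Rightarrow> 'a \<Rightarrow> complex"
    and H :: "('a \<Rightarrow> complex) set"
    and ip :: "('a \<Rightarrow> complex) \<Rightarrow> ('a \<Rightarrow> complex) \<Rightarrow> complex" +
  assumes kernel_mem: "y \<in> X \<Longrightarrow> kernel_section X K y \<in> H"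
    and reproducing: "f \<in> H \<Longrightarrow> y \<in> X \<Longrightarrow> f y = ip f (kernel_section X K y)"


section \<open>The weighted Korobov space\<close>

definition unit_cube :: "nat \<Rightarrow> (nat \<Rightarrow> real) set" where
  "unit_cube s = {1..s} \<rightarrow>\<^sub>E {0..1}"

definition product_weights :: "(nat \<Rightarrow> real) \<Rightarrow> nat set \<Rightarrow> real" where
  "product_weights \<gamma> u = (\<Prod>j\<in>u. \<gamma> j)"

definition korobov_kernel ::
    "nat \<Rightarrow> real \<Rightarrow> (nat set \<Rightarrow> real) \<Rightarrow> (nat \<Rightarrow> real) \<Rightarrow> (nat \<Rightarrow> real) \<Rightarrow> complex" where
  "korobov_kernel s \<alpha> wt x y =
     1 + (\<Sum>u\<in>Pow {1..s} - {{}}. of_real (wt u) *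
       (\<Sum>\<^sub>\<infinity>h\<in>u \<rightarrow>\<^sub>E (UNIV - {0::int}).
          exp (2 * of_real pi * \<i> * of_real (\<Sum>j\<in>u. of_int (h j) * (x j - y j)))
            / of_real (\<Prod>j\<in>u. \<bar>real_of_int (h j)\<bar> powr \<alpha>)))"


section \<open>Worst-case error of a rank-1 lattice rule\<close>

definition lattice_point :: "nat \<Rightarrow> nat \<Rightarrow> (nat \<Rightarrow> int) \<Rightarrow> nat \<Rightarrow> nat \<Rightarrow> real" where
  "lattice_point N s \<xi> n = (\<lambda>j\<in>{1..s}. frac (real n * real_of_int (\<xi> j) / real N))"

definition integration_error ::
    "nat \<Rightarrow> nat \<Rightarrow> (nat \<Rightarrow> int) \<Rightarrow> ((nat \<Rightarrow> real) \<Rightarrow> complex) \<Rightarrow> complex" where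
  "integration_error N s \<xi> f =
     (LINT x:unit_cube s|(\<Pi>\<^sub>M j\<in>{1..s}. lborel). f x)
       - (\<Sum>n<N. f (lattice_point N s \<xi> n)) / of_nat N"

definition worst_case_error ::
    "((nat \<Rightarrow> real) \<Rightarrow> complex) set
      \<Rightarrow> (((nat \<Rightarrow> real) \<Rightarrow> complex) \<Rightarrow> ((nat \<Rightarrow> real) \<Rightarrow> complex) \<Rightarrow> complex)
      \<Rightarrow> nat \<Rightarrow> nat \<Rightarrow> (nat \<Rightarrow> int) \<Rightarrow> real" where
  "worst_case_error H ip N s \<xi> =
     (SUP f\<in>{f \<in> H. ip_norm ip f \<le> 1}. cmod (integration_error N s \<xi> f))"


section \<open>The reduced successive coordinate search algorithm\<close>

definition search_space :: "nat \<Rightarrow> nat \<Rightarrow> nat \<Rightarrow> int set" where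
  "search_space b m v =
     (if v < m then {z \<in> {1..int b ^ (m - v) - 1}. coprime z (int b ^ m)} else {1})"

text \<open>
  The algorithm is nondeterministic when the minimizer is not unique: \<open>reduced_scs e b m w s z0 z\<close>
  says that \<open>z\<close> is a possible sequence of choices in a run that starts from \<open>z0\<close> and minimizes
  the square of the error \<open>e\<close>.
\<close>

definition reduced_scs ::
    "((nat \<Rightarrow> int) \<Rightarrow> real) \<Rightarrow> nat \<Rightarrow> nat \<Rightarrow> (nat \<Rightarrow> nat) \<Rightarrow> nat
      \<Rightarrow> (nat \<Rightarrow> int) \<Rightarrow> (nat \<Rightarrow> int) \<Rightarrow> bool" where
  "reduced_scs e b m w s z0 z \<longleftrightarrow>
     (\<forall>d\<in>{1..s}. is_arg_min
        (\<lambda>t. (e (\<lambda>j\<in>{1..s}. if j < d then int b ^ w j * z j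
                           else if j = d then int b ^ w d * t
                           else z0 j))\<^sup>2)
        (\<lambda>t. t \<in> search_space b m (w d)) (z d))"

definition scs_output :: "nat \<Rightarrow> (nat \<Rightarrow> nat) \<Rightarrow> nat \<Rightarrow> (nat \<Rightarrow> int) \<Rightarrow> nat \<Rightarrow> int" where
  "scs_output b w s z = (\<lambda>j\<in>{1..s}. int b ^ w j * z j)"


section \<open>The constant in the error bound\<close>

text \<open>The Dirichlet series of the Riemann zeta function; only meaningful for \<open>x > 1\<close>.\<close>

definition zeta_real :: "real \<Rightarrow> real" where
  "zeta_real x = (\<Sum>n. 1 / real (Suc n) powr x)"

definition scs_const ::
    "nat \<Rightarrow> (nat \<Rightarrow> nat) \<Rightarrow> nat \<Rightarrow> real \<Rightarrow> (nat \<Rightarrow> real) \<Rightarrow> real \<Rightarrow> real" where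
  "scs_const b w s \<alpha> \<gamma> \<delta> =
     ((\<Sum>d=1..s. \<gamma> d powr (1 / (\<alpha> - 2 * \<delta>)) * real b ^ w d)
       * (4 * zeta_real (\<alpha> / (\<alpha> - 2 * \<delta>)))
       * (\<Prod>d=1..s-1. 1 + \<gamma> d powr (1 / (\<alpha> - 2 * \<delta>)) * (2 * zeta_real (\<alpha> / (\<alpha> - 2 * \<delta>)))))
     powr (\<alpha> / 2 - \<delta>)"

end

theory Submission
  imports Defs "HOL-Number_Theory.Totient"
begin

text \<open>
  The kernel factorizes over the coordinates and expands as
  \<open>\<Sum>\<^sub>h \<rho>(h) exp(2\<pi>i h\<cdot>(x - y))\<close>. Kernel averages over finer and finer grids form a Cauchy sequence
  with limit the constant 1, and since every \<open>f\<close> in the space is continuous this identifies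
  integration with the inner product against 1. The squared worst-case error is therefore the
  squared norm of a representer, namely the sum of \<open>\<rho>(h)\<close> over the nonzero \<open>h\<close> of the dual lattice.

  In step \<open>d\<close> only the part \<open>\<theta>\<^sub>d\<close> of this sum with \<open>h\<^sub>d \<noteq> 0\<close> depends on the choice, and by
  \<open>(\<Sum>a)\<^sup>\<lambda> \<le> \<Sum>a\<^sup>\<lambda>\<close> with \<open>\<lambda> = 1/(\<alpha> - 2\<delta>)\<close> its minimum is controlled by the average over the search
  space of a sum with weights \<open>\<rho>\<^sup>\<lambda>\<close>, where solutions of one linear congruence have to be counted.
  Sorting the dual lattice by the largest index in the support of \<open>h\<close> shows that the final squared
  error is at most \<open>\<Sum>\<^sub>d \<theta>\<^sub>d\<close>.
\<close>

section \<open>Averaging a linear congruence over the search space\<close>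

text \<open>The space \<open>H\<close> is known only through its axioms. No Fourier series of its
  elements is at hand, and it has to be derived that the constant 1 lies in \<open>H\<close> and
  that elements of \<open>H\<close> are measurable. The explicit elements to start from are finite
  combinations of kernel sections, which is why integration is reached through grid averages. In the
  counting, the other coordinates contribute an arbitrary shift c, and h_d may share powers of b
  with the modulus. The averaging works because the weighted number of solutions stays below 2
  zeta(\<alpha> \<lambda>) for every c. The 4 in the constant is this 2, from the two signs of h_d,
  times another 2 from phi(b^M) >= b^M / 2. The range 0 < \<delta> <= (\<alpha> - 1)/2 says exactly
  that \<lambda> <= 1, for subadditivity, and \<alpha> \<lambda> > 1, for convergence. Step d yields
  a product over all j other than d; monotone weights turn it into the product up to s - 1.\<close>

definition int_powr :: "real \<Rightarrow> int \<Rightarrow> real" where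
  "int_powr \<beta> h = (if h = 0 then 0 else \<bar>real_of_int h\<bar> powr - \<beta>)"

lemma int_powr_nonneg: "int_powr \<beta> h \<ge> 0"
  by (simp add: int_powr_def)

lemma int_powr_mult: "int_powr \<beta> (a * h) = int_powr \<beta> a * int_powr \<beta> h"
  by (simp add: int_powr_def abs_mult powr_mult)

lemma int_powr_powr: "int_powr \<beta> h powr t = int_powr (\<beta> * t) h"
  by (simp add: int_powr_def powr_powr)

lemma summable_zeta_real:
  assumes "\<beta> > 1"
  shows "summable (\<lambda>n. 1 / real (Suc n) powr \<beta>)"
proof -
  have "summable (\<lambda>n. real n powr - \<beta>)"
    using assms by (subst summable_real_powr_iff) simp
  hence "summable (\<lambda>n. real (Suc n) powr - \<beta>)"
    by (subst (asm) summable_Suc_iff[symmetric])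
  thus ?thesis by (simp add: powr_minus_divide)
qed

lemma zeta_real_nonneg: "zeta_real \<beta> \<ge> 0" if "\<beta> > 1"
  unfolding zeta_real_def using summable_zeta_real[OF that] by (intro suminf_nonneg) auto

lemma sum_int_powr_le:
  assumes "\<beta> > 1" "finite H"
  shows "(\<Sum>h\<in>H. int_powr \<beta> h) \<le> 2 * zeta_real \<beta>"
proof -
  have half: "(\<Sum>h\<in>G. int_powr \<beta> h) \<le> zeta_real \<beta>"
    if "finite G" "inj_on abs G" "0 \<notin> G" for G
  proof -
    \<comment> \<open>The index of the term for |h| in \<open>zeta_real\<close>, whose summation
      starts at n = 0 with \<open>Suc n\<close>.\<close>
    define p where "p h = nat \<bar>h\<bar> - 1" for h :: int
    have *: "\<bar>real_of_int h\<bar> = real (Suc (p h))" if "h \<in> G" for h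
      using that \<open>0 \<notin> G\<close> unfolding p_def by (cases "h = 0") (auto simp: of_nat_diff Suc_le_eq)
    have inj: "inj_on p G"
    proof (rule inj_onI)
      fix x y assume xy: "x \<in> G" "y \<in> G" "p x = p y"
      hence "\<bar>x\<bar> = \<bar>y\<bar>" using *[of x] *[of y] by linarith
      thus "x = y" using xy that(2) by (auto dest: inj_onD)
    qed
    have "(\<Sum>h\<in>G. int_powr \<beta> h) = (\<Sum>h\<in>G. 1 / real (Suc (p h)) powr \<beta>)"
      using \<open>0 \<notin> G\<close> by (intro sum.cong) (auto simp: int_powr_def * powr_minus_divide simp del: of_nat_Suc)
    also have "\<dots> = (\<Sum>n\<in>p ` G. 1 / real (Suc n) powr \<beta>)"
      using inj by (subst sum.reindex) auto
    also have "\<dots> \<le> zeta_real \<beta>"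
      unfolding zeta_real_def using that by (intro sum_le_suminf summable_zeta_real assms) auto
    finally show ?thesis .
  qed
  have "(\<Sum>h\<in>H. int_powr \<beta> h) = (\<Sum>h\<in>{h\<in>H. h > 0} \<union> {h\<in>H. h < 0}. int_powr \<beta> h)"
    using assms by (intro sum.mono_neutral_right) (auto simp: int_powr_def)
  also have "\<dots> = (\<Sum>h\<in>{h\<in>H. h > 0}. int_powr \<beta> h) + (\<Sum>h\<in>{h\<in>H. h < 0}. int_powr \<beta> h)"
    using assms by (intro sum.union_disjoint) auto
  also have "\<dots> \<le> zeta_real \<beta> + zeta_real \<beta>"
    using assms by (intro add_mono half) (auto intro!: inj_onI)
  finally show ?thesis by simp
qed

lemma int_powr_summable: "\<beta> > 1 \<Longrightarrow> int_powr \<beta> summable_on UNIV"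
  by (intro nonneg_bdd_above_summable_on bdd_aboveI2[where M = "2 * zeta_real \<beta>"] sum_int_powr_le)
     (auto simp: int_powr_nonneg)

lemma zeta_real_pos: "zeta_real \<beta> > 0" if "\<beta> > 1"
  using that sum_int_powr_le[of \<beta> "{1}"] by (simp add: int_powr_def)

lemma finite_search_space: "finite (search_space b m w)"
  by (rule finite_subset[of _ "insert 1 {1..int b ^ (m - w) - 1}"])
     (auto simp: search_space_def)

text \<open>The totatives of b^M with M = m - w all belong to the search space, as b^M itself is not
  one of them, and phi(b^M) = b^(M-1) (b-1) >= b^M / 2 because b >= 2.\<close>

lemma card_search_space:
  assumes "prime b" "w < m"
  shows "real (card (search_space b m w)) * 2 \<ge> real b ^ (m - w)"
proof -
  have b: "b \<ge> 2" using assms prime_ge_2_nat by auto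
  define M where "M = m - w"
  have M: "M > 0" using assms by (simp add: M_def)
  have "int ` totatives (b ^ M) \<subseteq> search_space b m w"
  proof
    fix z assume "z \<in> int ` totatives (b ^ M)"
    then obtain k where k: "z = int k" "k > 0" "k \<le> b ^ M" "coprime k (b ^ M)"
      by (auto simp: totatives_def)
    have "coprime k b" using k M by simp
    hence cb: "coprime k (b ^ m)" by simp
    have "k \<noteq> b ^ M" using k(4) b M by (auto dest: coprime_common_divisor_nat)
    hence "k < b ^ M" using k by simp
    hence "int k < int b ^ M" by (metis of_nat_less_iff of_nat_power)
    moreover have "coprime (int k) (int b ^ m)" using cb by (metis coprime_int_iff of_nat_power)
    ultimately show "z \<in> search_space b m w"
      using k assms by (simp add: search_space_def M_def)
  qed
  moreover have "finite (search_space b m w)" by (rule finite_search_space)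
  ultimately have "card (int ` totatives (b ^ M)) \<le> card (search_space b m w)"
    by (intro card_mono)
  hence "totient (b ^ M) \<le> card (search_space b m w)"
    by (simp add: card_image totient_def)
  moreover have "totient (b ^ M) = b ^ (M - 1) * (b - 1)"
    using assms M by (simp add: totient_prime_power)
  moreover have "2 * (b ^ (M - 1) * (b - 1)) \<ge> b ^ (M - 1) * b"
  proof -
    have "b ^ (M - 1) * b \<le> b ^ (M - 1) * (2 * (b - 1))" using b by (intro mult_le_mono2) simp
    thus ?thesis by (simp only: mult.left_commute)
  qed
  moreover have "b ^ (M - 1) * b = b ^ M" using M by (cases M) auto
  ultimately have "b ^ M \<le> 2 * card (search_space b m w)" by linarith
  hence "real (b ^ M) \<le> real (2 * card (search_space b m w))" by (rule of_nat_mono)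
  thus ?thesis by (simp add: M_def)
qed

text \<open>The shift \<open>c\<close> will be the contribution of all coordinates but one, so the
  bound has to be uniform in it. In every case the left side is at most
  \<open>2 * zeta_real \<beta>\<close>. The right side is at least this: for w < m the search space
  has at least b^(m-w) / 2 elements, and otherwise it has one element and b^w / b^m >= 1.\<close>

lemma sum_int_powr_count_le:
  fixes c :: int
  assumes b: "prime b" and \<beta>: "\<beta> > 1" and H: "finite H"
  shows "(\<Sum>h\<in>H. int_powr \<beta> h * card {t\<in>search_space b m w. int b ^ m dvd int b ^ w * t * h + c})
           \<le> card (search_space b m w) * (4 * zeta_real \<beta> * real b ^ w / real b ^ m)"
proof (cases "w < m")
  case False
  have z0: "zeta_real \<beta> \<ge> 0" by (rule zeta_real_nonneg[OF \<beta>])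
  have "b > 0" using b prime_gt_0_nat by auto
  have "(\<Sum>h\<in>H. int_powr \<beta> h * card {t\<in>search_space b m w. int b ^ m dvd int b ^ w * t * h + c})
      \<le> (\<Sum>h\<in>H. int_powr \<beta> h * real 1)"
  proof (intro sum_mono mult_left_mono of_nat_mono int_powr_nonneg)
    fix h
    show "card {t\<in>search_space b m w. int b ^ m dvd int b ^ w * t * h + c} \<le> 1"
      using False card_mono[of "{1}" "{t\<in>search_space b m w. int b ^ m dvd int b ^ w * t * h + c}"]
      by (auto simp: search_space_def)
  qed
  also have "\<dots> \<le> 2 * zeta_real \<beta>" using sum_int_powr_le[OF \<beta> H] by simp
  also have "\<dots> \<le> 4 * zeta_real \<beta> * 1" using z0 by simp
  also have "\<dots> \<le> 4 * zeta_real \<beta> * (real b ^ w / real b ^ m)"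
    using False \<open>b > 0\<close> z0 power_increasing[of m w "real b"]
    by (intro mult_left_mono) simp_all
  finally show ?thesis using False by (simp add: search_space_def)
next
  case True
  define M where "M = m - w"
  have m: "m = w + M" "M > 0" using True by (auto simp: M_def)
  have b2: "b \<ge> 2" using b prime_ge_2_nat by auto
  have pb: "prime (int b)" using b by simp
  define Z where "Z = search_space b m w"
  have Z: "Z = {z \<in> {1..int b ^ M - 1}. coprime z (int b ^ m)}"
    using True by (simp add: Z_def search_space_def M_def)
  have copr: "coprime t (int b ^ k)" if "t \<in> Z" for t k
    using that m by (auto simp: Z)
  have z0: "zeta_real \<beta> \<ge> 0" by (rule zeta_real_nonneg[OF \<beta>])
  have rhs: "2 * zeta_real \<beta> \<le> card Z * (4 * zeta_real \<beta> * real b ^ w / real b ^ m)"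
  proof -
    have "real b ^ M \<le> 2 * card Z" using card_search_space[OF b True] by (simp add: Z_def M_def mult.commute)
    hence "zeta_real \<beta> * real b ^ M \<le> zeta_real \<beta> * (2 * card Z)" using z0 by (intro mult_left_mono)
    moreover have "4 * zeta_real \<beta> * real b ^ w / real b ^ m = 4 * zeta_real \<beta> / real b ^ M"
      using b2 by (simp add: m power_add)
    ultimately show ?thesis using b2 by (simp add: pos_le_divide_eq algebra_simps)
  qed
  \<comment> \<open>Both b^m and the term with \<open>t\<close> are divisible by b^w. Either the
    congruence has no solution at all, or b^w cancels and leaves the modulus b^M.\<close>
  show ?thesis
  proof (cases "int b ^ w dvd c")
    case False
    have "\<not> int b ^ m dvd int b ^ w * t * h + c" for t h
    proof
      assume "int b ^ m dvd int b ^ w * t * h + c"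
      hence "int b ^ w dvd int b ^ w * (t * h) + c"
        using m by (metis dvd_mult_left power_add mult.assoc)
      thus False using False by (simp add: dvd_add_right_iff)
    qed
    thus ?thesis using z0 by simp
  next
    case True
    then obtain c' where c': "c = int b ^ w * c'" by auto
    have iff: "int b ^ m dvd int b ^ w * t * h + c \<longleftrightarrow> int b ^ M dvd t * h + c'" for t h
    proof -
      have "int b ^ w * t * h + c = int b ^ w * (t * h + c')" by (simp add: c' algebra_simps)
      thus ?thesis using b2 by (simp add: m power_add)
    qed
    define sol where "sol h = {t\<in>Z. int b ^ M dvd t * h + c'}" for h
    \<comment> \<open>Let \<open>b\<^sup>k = gcd(c', b\<^sup>M)\<close>. The congruence is solvable only for multiples \<open>h\<close> of \<open>b\<^sup>k\<close> and then has at most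
      \<open>b\<^sup>k\<close> solutions \<open>t\<close>, a loss that the factor \<open>(b\<^sup>k)\<^sup>-\<^sup>\<beta>\<close> of \<open>|h|\<^sup>-\<^sup>\<beta>\<close> outweighs.\<close>
    define K where "K = {k. k \<le> M \<and> int b ^ k dvd c'}"
    define k where "k = Max K"
    have "finite K" "0 \<in> K" by (auto simp: K_def)
    hence "k \<in> K" unfolding k_def by (intro Max_in) auto
    hence k: "k \<le> M" "int b ^ k dvd c'" by (auto simp: K_def)
    \<comment> \<open>For k = M the maximum says nothing about b^(M+1); that case is settled below
      by b^(M-k) = 1.\<close>
    have kmax: "\<not> int b ^ Suc k dvd c'" if "k < M"
    proof
      assume "int b ^ Suc k dvd c'"
      hence "Suc k \<in> K" using that by (auto simp: K_def)
      thus False using \<open>finite K\<close> by (metis Max_ge k_def not_less_eq_eq order_refl)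
    qed
    have dvd_h: "int b ^ k dvd h" if "t \<in> sol h" for t h
    proof -
      have "int b ^ k dvd t * h + c'"
        using that k by (auto simp: sol_def intro: power_le_dvd)
      hence "int b ^ k dvd t * h" using k by (simp add: dvd_add_left_iff)
      moreover have "coprime (int b ^ k) t" using copr[of t k] that by (simp add: sol_def coprime_commute)
      ultimately show ?thesis by (simp add: coprime_dvd_mult_right_iff)
    qed
    have card_sol: "card (sol h) \<le> b ^ k" for h
    proof -
      \<comment> \<open>Two solutions are congruent modulo b^(M-k), so a solution is determined by
        its quotient by b^(M-k), and this quotient is below b^k because t < b^M.\<close>
      let ?f = "\<lambda>t. nat (t div int b ^ (M - k))"
      have "inj_on ?f (sol h)"
      proof (rule inj_onI)
        fix t t' assume t: "t \<in> sol h" "t' \<in> sol h" and eq: "?f t = ?f t'"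
        obtain q where q: "h = int b ^ k * q" using dvd_h[OF t(1)] by auto
        have "int b ^ M dvd (t * h + c') - (t' * h + c')"
          using t by (intro dvd_diff) (auto simp: sol_def)
        also have "(t * h + c') - (t' * h + c') = int b ^ k * ((t - t') * q)"
          by (simp add: q algebra_simps)
        also have "int b ^ M = int b ^ k * int b ^ (M - k)" using k by (simp flip: power_add)
        finally have d: "int b ^ (M - k) dvd (t - t') * q" using b2 by simp
        have "int b ^ (M - k) dvd t - t'"
        proof (cases "k < M")
          case True
          \<comment> \<open>Otherwise b^(k+1) would divide \<open>t * h\<close> and with it
            \<open>c'\<close>, against the maximality of k.\<close>
          have "\<not> int b dvd q"
          proof
            assume "int b dvd q"
            hence "int b ^ Suc k dvd t * h" by (auto simp: q mult.commute mult.left_commute)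
            moreover have "int b ^ Suc k dvd t * h + c'"
              using t True power_le_dvd[of "int b" M "t * h + c'" "Suc k"] by (simp add: sol_def)
            ultimately show False using kmax[OF True] by (simp add: dvd_add_right_iff)
          qed
          hence "coprime (int b ^ (M - k)) q" using pb by (simp add: prime_imp_coprime)
          thus ?thesis using d by (simp add: coprime_dvd_mult_left_iff)
        qed (use k in simp)
        moreover have "t div int b ^ (M - k) = t' div int b ^ (M - k)"
        proof -
          have "t \<ge> 0" "t' \<ge> 0" using t by (auto simp: sol_def Z)
          thus ?thesis using eq b2 by (simp add: pos_imp_zdiv_nonneg_iff eq_nat_nat_iff)
        qed
        ultimately show "t = t'"
          by (metis div_mult_mod_eq mod_eq_dvd_iff)
      qed
      moreover have "?f ` sol h \<subseteq> {..<b ^ k}"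
      proof safe
        fix t assume "t \<in> sol h"
        hence t: "0 \<le> t" "t < int b ^ M" by (auto simp: sol_def Z)
        have "int b ^ M = int b ^ k * int b ^ (M - k)" using k by (simp flip: power_add)
        moreover have "t div int b ^ (M - k) * int b ^ (M - k) \<le> t"
          using b2 by (simp flip: minus_mod_eq_div_mult)
        ultimately have "t div int b ^ (M - k) * int b ^ (M - k) < int b ^ k * int b ^ (M - k)"
          using t by linarith
        hence "t div int b ^ (M - k) < int b ^ k"
          using b2 by (simp add: mult_less_cancel_right)
        hence "nat (t div int b ^ (M - k)) < nat (int b ^ k)"
          using b2 by (subst nat_less_eq_zless) (auto simp: t pos_imp_zdiv_nonneg_iff)
        thus "?f t < b ^ k" by (simp add: nat_power_eq)
      qed
      ultimately show ?thesis using card_inj_on_le[of ?f "sol h" "{..<b ^ k}"] by simp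
    qed
    define H' where "H' = {h\<in>H. int b ^ k dvd h}"
    have "(\<Sum>h\<in>H. int_powr \<beta> h * card (sol h)) = (\<Sum>h\<in>H'. int_powr \<beta> h * card (sol h))"
    proof (intro sum.mono_neutral_right ballI)
      fix h assume "h \<in> H - H'"
      hence "sol h = {}" using dvd_h by (auto simp: H'_def)
      thus "int_powr \<beta> h * card (sol h) = 0" by simp
    qed (use H in \<open>auto simp: H'_def\<close>)
    also have "\<dots> \<le> (\<Sum>h\<in>H'. int_powr \<beta> h * (real b ^ k))"
      using card_sol by (intro sum_mono mult_left_mono int_powr_nonneg) (metis of_nat_le_iff of_nat_power)
    also have "\<dots> = (\<Sum>h\<in>H'. int_powr \<beta> (h div int b ^ k) * (real b ^ k) powr (1 - \<beta>))"
    proof (intro sum.cong refl)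
      fix h assume "h \<in> H'"
      then obtain q where q: "h = int b ^ k * q" by (auto simp: H'_def)
      have "int_powr \<beta> (int b ^ k) * real b ^ k = (real b ^ k) powr (1 - \<beta>)"
        using b2 by (simp add: int_powr_def powr_diff powr_minus field_simps)
      thus "int_powr \<beta> h * real b ^ k = int_powr \<beta> (h div int b ^ k) * (real b ^ k) powr (1 - \<beta>)"
        using b2 by (simp add: q int_powr_mult)
    qed
    also have "\<dots> \<le> (\<Sum>h\<in>H'. int_powr \<beta> (h div int b ^ k) * 1)"
    proof (intro sum_mono mult_left_mono int_powr_nonneg)
      have "(real b ^ k) powr (1 - \<beta>) \<le> (real b ^ k) powr 0"
        using b2 \<beta> by (intro powr_mono) auto
      thus "(real b ^ k) powr (1 - \<beta>) \<le> 1" using b2 by simp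
    qed
    also have "\<dots> = (\<Sum>h\<in>(\<lambda>h. h div int b ^ k) ` H'. int_powr \<beta> h)"
      by (subst sum.reindex) (auto simp: H'_def intro!: inj_onI dest: dvd_div_eq_cancel)
    also have "\<dots> \<le> 2 * zeta_real \<beta>"
      using H by (intro sum_int_powr_le \<beta>) (auto simp: H'_def)
    finally show ?thesis using rhs by (simp add: iff sol_def Z_def)
  qed
qed


section \<open>Representers in Hilbert function spaces\<close>

context hilbert_function_space
begin

lemma minus_mem: "f \<in> H \<Longrightarrow> g \<in> H \<Longrightarrow> (\<lambda>x. f x - g x) \<in> H"
  using add_mem[of f "\<lambda>x. (-1) * g x"] scale_mem[of g "-1"] by simp

lemma ip_diff:
  assumes "f \<in> H" "g \<in> H" "k \<in> H"
  shows "ip (\<lambda>x. f x - g x) k = ip f k - ip g k"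
  using ip_add[of f "\<lambda>x. (-1) * g x" k] ip_scale[of g k "-1"] scale_mem[of g "-1"] assms by simp

lemma ip_diff_right:
  assumes "f \<in> H" "g \<in> H" "k \<in> H"
  shows "ip k (\<lambda>x. f x - g x) = ip k f - ip k g"
  using ip_diff[OF assms] minus_mem[OF assms(1,2)] assms ip_cnj by (metis complex_cnj_diff)

lemma ip_scale_right: "f \<in> H \<Longrightarrow> g \<in> H \<Longrightarrow> ip g (\<lambda>x. c * f x) = cnj c * ip g f"
  using ip_scale[of f g c] scale_mem[of f c] ip_cnj by (metis complex_cnj_mult)

lemma sum_mem:
  assumes "finite P" "\<And>p. p \<in> P \<Longrightarrow> F p \<in> H"
  shows "(\<lambda>x. \<Sum>p\<in>P. F p x) \<in> H"
  using assms by (induction P rule: finite_induct) (auto intro: zero_mem add_mem)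

lemma ip_zero: "k \<in> H \<Longrightarrow> ip (\<lambda>x. 0) k = 0"
  using ip_scale[of "\<lambda>x. 0" k 0] zero_mem by simp

lemma ip_sum:
  assumes "finite P" "\<And>p. p \<in> P \<Longrightarrow> F p \<in> H" "k \<in> H"
  shows "ip (\<lambda>x. \<Sum>p\<in>P. F p x) k = (\<Sum>p\<in>P. ip (F p) k)"
  using assms by (induction P rule: finite_induct) (auto simp: ip_zero ip_add sum_mem)

lemma ip_sum_right:
  assumes "finite P" "\<And>p. p \<in> P \<Longrightarrow> F p \<in> H" "k \<in> H"
  shows "ip k (\<lambda>x. \<Sum>p\<in>P. F p x) = (\<Sum>p\<in>P. ip k (F p))"
proof -
  have "ip k (\<lambda>x. \<Sum>p\<in>P. F p x) = cnj (\<Sum>p\<in>P. ip (F p) k)"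
    using ip_cnj[OF sum_mem[OF assms(1,2)] assms(3)] ip_sum[OF assms] by simp
  also have "\<dots> = (\<Sum>p\<in>P. ip k (F p))"
    using assms by (auto simp: ip_cnj[of _ k] intro!: sum.cong)
  finally show ?thesis .
qed

lemma ip_self_nonneg: "f \<in> H \<Longrightarrow> Re (ip f f) \<ge> 0"
  using ip_pos[of f] ip_zero[OF zero_mem] by (cases "f = (\<lambda>x. 0)") auto

lemma ip_norm_nonneg: "f \<in> H \<Longrightarrow> ip_norm ip f \<ge> 0"
  by (simp add: ip_norm_def ip_self_nonneg)

lemma ip_self: "f \<in> H \<Longrightarrow> ip f f = of_real ((ip_norm ip f)\<^sup>2)"
  using ip_cnj[of f f] by (simp add: ip_norm_def ip_self_nonneg complex_eq_iff)

lemma ip_norm_eq_0: "f \<in> H \<Longrightarrow> ip_norm ip f = 0 \<Longrightarrow> f = (\<lambda>x. 0)"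
  using ip_pos[of f] by (fastforce simp: ip_norm_def)

lemma ip_norm_scale: "f \<in> H \<Longrightarrow> ip_norm ip (\<lambda>x. c * f x) = cmod c * ip_norm ip f"
proof -
  assume f: "f \<in> H"
  have "ip (\<lambda>x. c * f x) (\<lambda>x. c * f x) = (c * cnj c) * ip f f"
    using f by (simp add: ip_scale ip_scale_right scale_mem)
  also have "\<dots> = of_real ((cmod c * ip_norm ip f)\<^sup>2)"
    using f by (simp only: ip_self complex_norm_square[symmetric]) (simp add: power_mult_distrib)
  finally show ?thesis using f
    by (simp add: ip_norm_def[of ip "\<lambda>x. c * f x"] ip_norm_nonneg del: of_real_power of_real_mult)
qed

lemma Cauchy_Schwarz:
  assumes "f \<in> H" "g \<in> H"
  shows "cmod (ip f g) \<le> ip_norm ip f * ip_norm ip g"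
proof (cases "g = (\<lambda>x. 0)")
  case True
  hence "ip f g = 0" using ip_cnj[of g f] ip_zero[of f] assms by simp
  thus ?thesis using assms by (simp add: ip_norm_nonneg)
next
  case False
  define G where "G = (ip_norm ip g)\<^sup>2"
  define a where "a = ip f g"
  have G: "G > 0" using ip_norm_eq_0[of g] False assms by (auto simp: G_def)
  \<comment> \<open>This coefficient makes \<open>k\<close> orthogonal to \<open>g\<close>, so the
    squared norm of \<open>k\<close> is that of \<open>f\<close> minus |a|^2 / G, and it cannot be
    negative.\<close>
  define c where "c = a / of_real G"
  define k where "k = (\<lambda>x. f x - c * g x)"
  have cg: "(\<lambda>x. c * g x) \<in> H" by (simp add: scale_mem assms)
  have k: "k \<in> H" unfolding k_def by (intro minus_mem cg assms)
  have "ip k k = ip f f - cnj c * a - c * cnj a + c * cnj c * of_real G"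
    using assms cg minus_mem[OF assms(1) cg] ip_cnj[of f g]
    by (simp add: k_def ip_diff ip_diff_right ip_scale ip_scale_right a_def ip_self[of g] G_def algebra_simps)
  also have "cnj c * a = of_real ((cmod a)\<^sup>2 / G)"
    by (simp add: c_def complex_norm_square mult.commute del: of_real_power)
  also have "c * cnj a = of_real ((cmod a)\<^sup>2 / G)"
    by (simp add: c_def complex_norm_square mult.commute del: of_real_power)
  also have "c * cnj c * of_real G = of_real ((cmod a)\<^sup>2 / G)"
    using G by (simp add: c_def complex_norm_square mult.commute del: of_real_power)
  finally have "of_real ((ip_norm ip k)\<^sup>2) = (of_real ((ip_norm ip f)\<^sup>2 - (cmod a)\<^sup>2 / G) :: complex)"
    using k assms by (simp add: ip_self)
  hence "(ip_norm ip k)\<^sup>2 = (ip_norm ip f)\<^sup>2 - (cmod a)\<^sup>2 / G"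
    by (simp only: of_real_eq_iff)
  hence "(cmod a)\<^sup>2 / G \<le> (ip_norm ip f)\<^sup>2" by (smt (verit) zero_le_power2)
  hence "(cmod a)\<^sup>2 \<le> (ip_norm ip f * ip_norm ip g)\<^sup>2"
    using G by (simp add: pos_divide_le_eq power_mult_distrib G_def)
  thus ?thesis unfolding a_def
    by (rule power2_le_imp_le) (simp add: ip_norm_nonneg assms)
qed

text \<open>Cauchy-Schwarz gives one direction, \<open>g\<close> scaled to norm 1 the other. This
  turns the supremum in the worst-case error into the norm of one explicit function.\<close>

lemma SUP_unit_ball_functional:
  assumes g: "g \<in> H"
  shows "(SUP f\<in>{f \<in> H. ip_norm ip f \<le> 1}. cmod (ip f g)) = ip_norm ip g"
proof (rule antisym)
  have ne: "{f \<in> H. ip_norm ip f \<le> 1} \<noteq> {}"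
    using zero_mem ip_zero[OF zero_mem] by (auto simp: ip_norm_def)
  have le: "cmod (ip f g) \<le> ip_norm ip g" if "f \<in> {f \<in> H. ip_norm ip f \<le> 1}" for f
    using that Cauchy_Schwarz[of f g] mult_right_mono[of "ip_norm ip f" 1 "ip_norm ip g"] g
    by (auto simp: ip_norm_nonneg)
  show "(SUP f\<in>{f \<in> H. ip_norm ip f \<le> 1}. cmod (ip f g)) \<le> ip_norm ip g"
    using ne le by (rule cSUP_least)
  have bdd: "bdd_above ((\<lambda>f. cmod (ip f g)) ` {f \<in> H. ip_norm ip f \<le> 1})"
    using le by (rule bdd_aboveI2)
  show "ip_norm ip g \<le> (SUP f\<in>{f \<in> H. ip_norm ip f \<le> 1}. cmod (ip f g))"
  proof (cases "ip_norm ip g = 0")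
    case True
    hence "ip_norm ip g \<le> cmod (ip g g)" by simp
    also have "\<dots> \<le> (SUP f\<in>{f \<in> H. ip_norm ip f \<le> 1}. cmod (ip f g))"
      using True g by (intro cSUP_upper bdd) simp
    finally show ?thesis .
  next
    case False
    hence pos: "ip_norm ip g > 0" using ip_norm_nonneg[OF g] by simp
    define f where "f = (\<lambda>x. of_real (1 / ip_norm ip g) * g x)"
    have f: "f \<in> H" unfolding f_def by (intro scale_mem g)
    have "ip_norm ip f = 1" using pos g unfolding f_def by (subst ip_norm_scale) (auto simp: norm_divide)
    moreover have "ip f g = of_real (ip_norm ip g)"
      unfolding f_def using pos g by (subst ip_scale) (auto simp: ip_self power2_eq_square)
    ultimately show ?thesis
      using f pos by (intro cSUP_upper2[OF bdd, of f]) auto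
  qed
qed

end

context rkhs
begin

lemma kernel_sum_mem:
  assumes "finite P" "\<And>p. p \<in> P \<Longrightarrow> x p \<in> X"
  shows "(\<lambda>t. \<Sum>p\<in>P. c p * kernel_section X K (x p) t) \<in> H"
  using assms by (intro sum_mem scale_mem kernel_mem) auto

text \<open>A quadrature rule is represented by the combination of kernel sections with conjugated
  weights. The nodes form an indexed family rather than a set, since the points of a lattice rule
  may coincide.\<close>

lemma ip_kernel_sum:
  assumes "finite P" "\<And>p. p \<in> P \<Longrightarrow> x p \<in> X" "f \<in> H"
  shows "ip f (\<lambda>t. \<Sum>p\<in>P. c p * kernel_section X K (x p) t) = (\<Sum>p\<in>P. cnj (c p) * f (x p))"
proof -
  have "ip f (\<lambda>t. \<Sum>p\<in>P. c p * kernel_section X K (x p) t)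
      = (\<Sum>p\<in>P. ip f (\<lambda>t. c p * kernel_section X K (x p) t))"
    using assms by (intro ip_sum_right scale_mem kernel_mem) auto
  also have "\<dots> = (\<Sum>p\<in>P. cnj (c p) * f (x p))"
    using assms by (intro sum.cong) (auto simp: ip_scale_right kernel_mem reproducing[symmetric])
  finally show ?thesis .
qed

lemma ip_self_kernel_sum:
  fixes c :: "'p \<Rightarrow> complex" and x :: "'p \<Rightarrow> 'a"
  assumes "finite P" "\<And>p. p \<in> P \<Longrightarrow> x p \<in> X"
  defines "g \<equiv> \<lambda>t. \<Sum>p\<in>P. c p * kernel_section X K (x p) t"
  shows "ip g g = (\<Sum>q\<in>P. \<Sum>p\<in>P. cnj (c q) * c p * K (x q) (x p))"
proof -
  have "ip g g = (\<Sum>q\<in>P. cnj (c q) * g (x q))"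
    unfolding g_def using assms(1,2) by (intro ip_kernel_sum kernel_sum_mem)
  thus ?thesis
    using assms(2) by (simp add: g_def kernel_section_def sum_distrib_left mult.assoc)
qed

end


section \<open>Fourier expansion of the Korobov kernel\<close>

text \<open>Dominated convergence for the counting measure on \<open>A\<close>, with
  \<open>C * \<rho> h\<close> as majorant. It serves both the continuity of the functions in the
  space and the decay of the aliasing error of the grids.\<close>

lemma infsum_dominated_tendsto_0:
  fixes \<rho> :: "'a \<Rightarrow> real" and c :: "nat \<Rightarrow> 'a \<Rightarrow> real"
  assumes "\<rho> summable_on A" "\<And>h. h \<in> A \<Longrightarrow> \<rho> h \<ge> 0"
    and "\<And>n h. h \<in> A \<Longrightarrow> \<bar>c n h\<bar> \<le> C" "\<And>h. h \<in> A \<Longrightarrow> (\<lambda>n. c n h) \<longlonglongrightarrow> 0"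
  shows "(\<lambda>n. \<Sum>\<^sub>\<infinity>h\<in>A. \<rho> h * c n h) \<longlonglongrightarrow> 0"
proof -
  have sum: "(\<lambda>h. C * \<rho> h) summable_on A" using assms(1) by (rule summable_on_cmult_right)
  have le: "norm (\<rho> h * c n h) \<le> C * \<rho> h" if "h \<in> A" for n h
    using mult_left_mono[OF assms(3)[OF that, of n] assms(2)[OF that]] assms(2)[OF that]
    by (simp add: abs_mult mult.commute)
  have abs: "integrable (count_space A) (\<lambda>h. C * \<rho> h)"
    using sum by (metis abs_summable_equivalent abs_summable_on_def summable_on_iff_abs_summable_on_real)
  have "(\<lambda>n. \<integral>h. \<rho> h * c n h \<partial>count_space A) \<longlonglongrightarrow> (\<integral>h. 0 \<partial>count_space A)"
  proof (rule integral_dominated_convergence[OF _ _ abs])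
    show "AE h in count_space A. (\<lambda>n. \<rho> h * c n h) \<longlonglongrightarrow> 0"
      using tendsto_mult[OF tendsto_const assms(4)] by (auto simp: AE_count_space)
  qed (use le in \<open>auto simp: AE_count_space\<close>)
  moreover have "(\<integral>h. \<rho> h * c n h \<partial>count_space A) = (\<Sum>\<^sub>\<infinity>h\<in>A. \<rho> h * c n h)" for n
  proof -
    have "(\<lambda>h. norm (\<rho> h * c n h)) summable_on A"
      by (rule summable_on_comparison_test[OF sum le]) auto
    thus ?thesis unfolding abs_summable_equivalent
      by (simp add: infsetsum_infsum flip: infsetsum_def)
  qed
  ultimately show ?thesis by simp
qed

lemma has_sum_finite_sum:
  fixes f :: "'p \<Rightarrow> 'a \<Rightarrow> 'b :: {topological_comm_monoid_add, t2_space}"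
  assumes "finite P" "\<And>p. p \<in> P \<Longrightarrow> f p summable_on A"
  shows "((\<lambda>h. \<Sum>p\<in>P. f p h) has_sum (\<Sum>p\<in>P. infsum (f p) A)) A"
  using assms by (induction P rule: finite_induct) (auto intro!: has_sum_add)

lemmas infsum_finite_sum = infsumI[OF has_sum_finite_sum]
  and summable_on_finite_sum = has_sum_imp_summable[OF has_sum_finite_sum]

section \<open>Fourier coefficients of the kernel\<close>

definition korobov_factor :: "real \<Rightarrow> real \<Rightarrow> int \<Rightarrow> real" where
  "korobov_factor \<alpha> g a = of_bool (a = 0) + g * int_powr \<alpha> a"

text \<open>The product of \<gamma>_j |h_j|^-\<alpha> over the support of h. Since
  \<open>int_powr\<close> vanishes at 0, at most one summand of each factor is nonzero; zero
  components contribute 1, and the sums over all subsets u merge into a single sum over h.\<close>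

definition korobov_coeff :: "nat \<Rightarrow> real \<Rightarrow> (nat \<Rightarrow> real) \<Rightarrow> (nat \<Rightarrow> int) \<Rightarrow> real" where
  "korobov_coeff s \<alpha> \<gamma> h = (\<Prod>j\<in>{1..s}. korobov_factor \<alpha> (\<gamma> j) (h j))"

definition frequencies :: "nat \<Rightarrow> (nat \<Rightarrow> int) set" where
  "frequencies s = {1..s} \<rightarrow>\<^sub>E UNIV"

definition wave :: "nat \<Rightarrow> (nat \<Rightarrow> int) \<Rightarrow> (nat \<Rightarrow> real) \<Rightarrow> complex" where
  "wave s h x = cis (2 * pi * (\<Sum>j\<in>{1..s}. of_int (h j) * x j))"

lemma norm_wave [simp]: "cmod (wave s h x) = 1"
  by (simp add: wave_def)

lemma korobov_factor_nonneg: "g \<ge> 0 \<Longrightarrow> korobov_factor \<alpha> g a \<ge> 0"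
  by (simp add: korobov_factor_def int_powr_nonneg)

lemma korobov_coeff_nonneg:
  "(\<And>j. j \<in> {1..s} \<Longrightarrow> \<gamma> j \<ge> 0) \<Longrightarrow> korobov_coeff s \<alpha> \<gamma> h \<ge> 0"
  unfolding korobov_coeff_def by (intro prod_nonneg) (auto intro: korobov_factor_nonneg)

lemma korobov_factor_summable:
  assumes "\<alpha> > 1"
  shows "korobov_factor \<alpha> g summable_on UNIV"
proof -
  have "(\<lambda>a::int. of_bool (a = 0) :: real) summable_on UNIV"
    by (rule finite_nonzero_values_imp_summable_on) auto
  thus ?thesis unfolding korobov_factor_def
    by (intro summable_on_add summable_on_cmult_right int_powr_summable assms)
qed

lemma sum_korobov_factor_le:
  assumes "\<alpha> > 1" "finite F" "g \<ge> 0"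
  shows "(\<Sum>a\<in>F. korobov_factor \<alpha> g a) \<le> 1 + g * (2 * zeta_real \<alpha>)"
proof -
  have "(\<Sum>a\<in>F. of_bool (a = 0) :: real) \<le> 1"
    using assms(2) by (simp add: of_bool_def sum.delta)
  moreover have "(\<Sum>a\<in>F. g * int_powr \<alpha> a) \<le> g * (2 * zeta_real \<alpha>)"
    unfolding sum_distrib_left[symmetric] using assms by (intro mult_left_mono sum_int_powr_le)
  ultimately show ?thesis unfolding korobov_factor_def sum.distrib by linarith
qed

text \<open>A sum over a box factors into one-dimensional sums, so nonnegative sums over finite sets
  of frequencies are estimated by enlarging the set to a box.\<close>

lemma finite_subset_frequencies:
  assumes "finite F" "F \<subseteq> frequencies s"
  obtains T where "finite T" "F \<subseteq> {1..s} \<rightarrow>\<^sub>E T"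
proof
  show "finite (\<Union>j\<in>{1..s}. (\<lambda>h. h j) ` F)" using assms by auto
  show "F \<subseteq> {1..s} \<rightarrow>\<^sub>E (\<Union>j\<in>{1..s}. (\<lambda>h. h j) ` F)"
    using assms(2) by (auto simp: frequencies_def PiE_def Pi_def)
qed

lemma korobov_coeff_summable:
  assumes "\<alpha> > 1" "\<And>j. j \<in> {1..s} \<Longrightarrow> \<gamma> j \<ge> 0"
  shows "korobov_coeff s \<alpha> \<gamma> summable_on frequencies s"
proof (rule nonneg_bdd_above_summable_on)
  show "bdd_above (sum (korobov_coeff s \<alpha> \<gamma>) ` {F. F \<subseteq> frequencies s \<and> finite F})"
  proof (rule bdd_aboveI2)
    fix F assume "F \<in> {F. F \<subseteq> frequencies s \<and> finite F}"
    then obtain T where T: "finite T" "F \<subseteq> {1..s} \<rightarrow>\<^sub>E T"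
      using finite_subset_frequencies[of F s] by auto
    have "sum (korobov_coeff s \<alpha> \<gamma>) F \<le> sum (korobov_coeff s \<alpha> \<gamma>) ({1..s} \<rightarrow>\<^sub>E T)"
      using T assms by (intro sum_mono2 korobov_coeff_nonneg) (auto intro: finite_PiE)
    also have "\<dots> = (\<Prod>j\<in>{1..s}. \<Sum>a\<in>T. korobov_factor \<alpha> (\<gamma> j) a)"
      unfolding korobov_coeff_def using T by (subst prod_sum_PiE) auto
    also have "\<dots> \<le> (\<Prod>j\<in>{1..s}. 1 + \<gamma> j * (2 * zeta_real \<alpha>))"
      using assms T by (intro prod_mono conjI sum_korobov_factor_le sum_nonneg korobov_factor_nonneg) auto
    finally show "sum (korobov_coeff s \<alpha> \<gamma>) F \<le> (\<Prod>j\<in>{1..s}. 1 + \<gamma> j * (2 * zeta_real \<alpha>))" .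
  qed
qed (use assms korobov_coeff_nonneg in auto)

lemma korobov_coeff_mult_summable:
  fixes c :: "(nat \<Rightarrow> int) \<Rightarrow> 'a :: {banach, real_normed_algebra_1}"
  assumes "\<alpha> > 1" "\<And>j. j \<in> {1..s} \<Longrightarrow> \<gamma> j \<ge> 0" "\<And>h. h \<in> frequencies s \<Longrightarrow> norm (c h) \<le> C"
  shows "(\<lambda>h. of_real (korobov_coeff s \<alpha> \<gamma> h) * c h) summable_on frequencies s"
proof (rule abs_summable_summable, rule summable_on_comparison_test)
  show "(\<lambda>h. C * korobov_coeff s \<alpha> \<gamma> h) summable_on frequencies s"
    using assms by (intro summable_on_cmult_right korobov_coeff_summable)
  fix h assume "h \<in> frequencies s"
  hence "norm (c h) \<le> C" by (rule assms)
  moreover have "norm (of_real (korobov_coeff s \<alpha> \<gamma> h) * c h :: 'a) \<le> korobov_coeff s \<alpha> \<gamma> h * norm (c h)"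
    using korobov_coeff_nonneg[of s \<gamma> \<alpha> h] assms(2)
    by (intro order.trans[OF norm_mult_ineq]) simp
  ultimately show "norm (of_real (korobov_coeff s \<alpha> \<gamma> h) * c h :: 'a) \<le> C * korobov_coeff s \<alpha> \<gamma> h"
    using mult_left_mono[of "norm (c h)" C "korobov_coeff s \<alpha> \<gamma> h"] korobov_coeff_nonneg[of s \<gamma> \<alpha> h] assms(2)
    by (simp add: mult.commute)
qed simp

lemma wave_diff: "wave s h (\<lambda>j. x j - y j) = wave s h x * cnj (wave s h y)"
  by (simp add: wave_def cis_cnj cis_mult right_diff_distrib sum_subtractf)

text \<open>The sum over u is the expanded form of the product of the factors 1 + \<gamma>_j
  \<phi>_j, the empty set giving the leading 1. In each factor the 1 is the missing term a = 0 of
  the series \<open>\<phi> j\<close>, and absolute convergence allows multiplying these series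
  out.\<close>

lemma korobov_kernel_expansion:
  assumes \<alpha>: "\<alpha> > 1" and \<gamma>: "\<And>j. j \<in> {1..s} \<Longrightarrow> \<gamma> j \<ge> 0"
  shows "korobov_kernel s \<alpha> (product_weights \<gamma>) x y =
    (\<Sum>\<^sub>\<infinity>h\<in>frequencies s. of_real (korobov_coeff s \<alpha> \<gamma> h) * (wave s h x * cnj (wave s h y)))"
proof -
  define f where "f j a = cis (2 * pi * (of_int a * (x j - y j)))" for j and a :: int
  define \<phi> where "\<phi> j = (\<Sum>\<^sub>\<infinity>a\<in>UNIV - {0}. of_real (int_powr \<alpha> a) * f j a)" for j
  have norm_f: "norm (f j a) = 1" for j a by (simp add: f_def)
  have sum0: "(\<lambda>a. norm (of_real (int_powr \<alpha> a) * f j a)) summable_on A" for j A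
    using summable_on_subset_banach[OF int_powr_summable[OF \<alpha>], of A]
    by (simp add: norm_mult norm_f int_powr_nonneg)
  have sum1: "(\<lambda>a. norm (of_real (korobov_factor \<alpha> (\<gamma> j) a) * f j a)) summable_on UNIV" if "j \<in> {1..s}" for j
    using korobov_factor_summable[OF \<alpha>, of "\<gamma> j"] \<gamma>[OF that]
    by (simp add: norm_mult norm_f korobov_factor_nonneg)
  have inner: "(\<Sum>\<^sub>\<infinity>h\<in>u \<rightarrow>\<^sub>E (UNIV - {0::int}).
          exp (2 * of_real pi * \<i> * of_real (\<Sum>j\<in>u. of_int (h j) * (x j - y j)))
            / of_real (\<Prod>j\<in>u. \<bar>real_of_int (h j)\<bar> powr \<alpha>)) = (\<Prod>j\<in>u. \<phi> j)" (is "?L = _")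
    if "u \<subseteq> {1..s}" for u
  proof -
    have fin: "finite u" using that finite_subset by blast
    have "?L = (\<Sum>\<^sub>\<infinity>h\<in>u \<rightarrow>\<^sub>E (UNIV - {0::int}). \<Prod>j\<in>u. of_real (int_powr \<alpha> (h j)) * f j (h j))"
    proof (rule infsum_cong)
      fix h assume h: "h \<in> u \<rightarrow>\<^sub>E (UNIV - {0::int})"
      have "exp (2 * of_real pi * \<i> * of_real (\<Sum>j\<in>u. of_int (h j) * (x j - y j))) =
            (\<Prod>j\<in>u. f j (h j))"
        using fin by (simp add: f_def cis_conv_exp exp_sum[symmetric] sum_distrib_left mult_ac)
      moreover have "of_real (int_powr \<alpha> (h j)) = 1 / (of_real (\<bar>real_of_int (h j)\<bar> powr \<alpha>) :: complex)"
        if "j \<in> u" for j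
      proof -
        have "h j \<noteq> 0" using that h by auto
        thus ?thesis by (simp add: int_powr_def powr_minus_divide)
      qed
      ultimately show "exp (2 * of_real pi * \<i> * of_real (\<Sum>j\<in>u. of_int (h j) * (x j - y j)))
            / of_real (\<Prod>j\<in>u. \<bar>real_of_int (h j)\<bar> powr \<alpha>) = 
          (\<Prod>j\<in>u. of_real (int_powr \<alpha> (h j)) * f j (h j))"
        by (simp add: prod.distrib prod_dividef)
    qed
    also have "\<dots> = (\<Prod>j\<in>u. \<phi> j)"
      unfolding \<phi>_def using fin sum0 by (subst infsum_prod_PiE_abs) auto
    finally show ?thesis .
  qed
  have factor: "of_real (\<gamma> j) * \<phi> j + 1 = (\<Sum>\<^sub>\<infinity>a. of_real (korobov_factor \<alpha> (\<gamma> j) a) * f j a)" for j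
  proof -
    have "(\<Sum>\<^sub>\<infinity>a. of_real (korobov_factor \<alpha> (\<gamma> j) a) * f j a)
        = (\<Sum>\<^sub>\<infinity>a. of_real (\<gamma> j) * (of_real (int_powr \<alpha> a) * f j a) + of_bool (a = 0))"
      by (intro infsum_cong) (auto simp: korobov_factor_def f_def algebra_simps)
    also have "\<dots> = (\<Sum>\<^sub>\<infinity>a. of_real (\<gamma> j) * (of_real (int_powr \<alpha> a) * f j a)) + (\<Sum>\<^sub>\<infinity>a::int. of_bool (a = 0))"
      by (intro infsum_add summable_on_cmult_right abs_summable_summable[OF sum0]
          finite_nonzero_values_imp_summable_on) auto
    also have "(\<Sum>\<^sub>\<infinity>a::int. of_bool (a = 0)) = (\<Sum>\<^sub>\<infinity>a\<in>{0::int}. 1 :: complex)"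
      by (intro infsum_cong_neutral) auto
    also have "(\<Sum>\<^sub>\<infinity>a. of_real (\<gamma> j) * (of_real (int_powr \<alpha> a) * f j a)) = of_real (\<gamma> j) * \<phi> j"
      unfolding \<phi>_def
      by (subst infsum_cmult_right'[symmetric], intro infsum_cong_neutral) (auto simp: int_powr_def)
    finally show ?thesis by simp
  qed
  have "korobov_kernel s \<alpha> (product_weights \<gamma>) x y
      = 1 + (\<Sum>u\<in>Pow {1..s} - {{}}. of_real (\<Prod>j\<in>u. \<gamma> j) * (\<Prod>j\<in>u. \<phi> j))"
    unfolding korobov_kernel_def product_weights_def
    by (intro arg_cong2[of _ _ _ _ "(+)"] sum.cong refl arg_cong2[of _ _ _ _ "(*)"] inner) auto
  also have "\<dots> = (\<Sum>u\<in>Pow {1..s}. \<Prod>j\<in>u. of_real (\<gamma> j) * \<phi> j)"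
    by (subst sum.remove[of "Pow {1..s}" "{}"]) (auto simp: prod.distrib)
  also have "\<dots> = (\<Prod>j\<in>{1..s}. of_real (\<gamma> j) * \<phi> j + 1)"
    by (subst prod_add) auto
  also have "\<dots> = (\<Prod>j\<in>{1..s}. \<Sum>\<^sub>\<infinity>a. of_real (korobov_factor \<alpha> (\<gamma> j) a) * f j a)"
    by (simp only: factor)
  also have "\<dots> = (\<Sum>\<^sub>\<infinity>h\<in>frequencies s. \<Prod>j\<in>{1..s}. of_real (korobov_factor \<alpha> (\<gamma> j) (h j)) * f j (h j))"
    unfolding frequencies_def using sum1 by (subst infsum_prod_PiE_abs) auto
  also have "\<dots> = (\<Sum>\<^sub>\<infinity>h\<in>frequencies s. of_real (korobov_coeff s \<alpha> \<gamma> h) * (wave s h x * cnj (wave s h y)))"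
  proof (intro infsum_cong)
    fix h
    have "(\<Prod>j\<in>{1..s}. f j (h j)) = wave s h (\<lambda>j. x j - y j)"
      by (simp add: f_def wave_def cis_conv_exp exp_sum[symmetric] sum_distrib_left mult_ac)
    thus "(\<Prod>j\<in>{1..s}. of_real (korobov_factor \<alpha> (\<gamma> j) (h j)) * f j (h j)) =
          of_real (korobov_coeff s \<alpha> \<gamma> h) * (wave s h x * cnj (wave s h y))"
      by (simp add: prod.distrib korobov_coeff_def wave_diff)
  qed
  finally show ?thesis .
qed

section \<open>Norms of kernel sums and continuity of the functions in the space\<close>

locale korobov_space =
  rkhs "unit_cube s" "korobov_kernel s \<alpha> (product_weights \<gamma>)" H ip
  for s :: nat and \<alpha> :: real and \<gamma> :: "nat \<Rightarrow> real"
    and H :: "((nat \<Rightarrow> real) \<Rightarrow> complex) set" and ip +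
  assumes \<alpha>: "\<alpha> > 1" and \<gamma>: "j \<in> {1..s} \<Longrightarrow> \<gamma> j \<ge> 0"
begin

abbreviation kernel_at :: "(nat \<Rightarrow> real) \<Rightarrow> (nat \<Rightarrow> real) \<Rightarrow> complex" where
  "kernel_at \<equiv> kernel_section (unit_cube s) (korobov_kernel s \<alpha> (product_weights \<gamma>))"

abbreviation \<rho> :: "(nat \<Rightarrow> int) \<Rightarrow> real" where
  "\<rho> \<equiv> korobov_coeff s \<alpha> \<gamma>"

lemma \<rho>_nonneg: "\<rho> h \<ge> 0"
  using \<gamma> by (rule korobov_coeff_nonneg)

lemma \<rho>_summable: "\<rho> summable_on frequencies s"
  using \<alpha> \<gamma> by (rule korobov_coeff_summable)

lemma \<rho>_mult_summable:
  fixes c :: "(nat \<Rightarrow> int) \<Rightarrow> 'a :: {banach, real_normed_algebra_1}"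
  shows "(\<And>h. h \<in> frequencies s \<Longrightarrow> norm (c h) \<le> C)
    \<Longrightarrow> (\<lambda>h. of_real (\<rho> h) * c h) summable_on frequencies s"
  using \<alpha> \<gamma> by (rule korobov_coeff_mult_summable)

lemma kernel_expansion: "korobov_kernel s \<alpha> (product_weights \<gamma>) x y =
    (\<Sum>\<^sub>\<infinity>h\<in>frequencies s. of_real (\<rho> h) * (wave s h x * cnj (wave s h y)))"
  using \<alpha> \<gamma> by (rule korobov_kernel_expansion)

lemma \<rho>_mult_summable_real:
  "(\<And>h. h \<in> frequencies s \<Longrightarrow> \<bar>c h\<bar> \<le> C) \<Longrightarrow> (\<lambda>h. \<rho> h * c h) summable_on frequencies s"
  using \<rho>_mult_summable[where c = c and C = C] by simp

text \<open>The expansion diagonalizes the Gram matrix of the kernel sections: for each frequency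
  the double sum over nodes is a squared modulus. Norms of kernel sums thereby reduce to exponential
  sums over the nodes.\<close>

lemma ip_norm_kernel_sum:
  fixes c :: "'p \<Rightarrow> complex"
  assumes "finite P" "\<And>p. p \<in> P \<Longrightarrow> x p \<in> unit_cube s"
  shows "(ip_norm ip (\<lambda>t. \<Sum>p\<in>P. c p * kernel_at (x p) t))\<^sup>2
    = (\<Sum>\<^sub>\<infinity>h\<in>frequencies s. \<rho> h * (cmod (\<Sum>p\<in>P. cnj (c p) * wave s h (x p)))\<^sup>2)"
proof -
  let ?g = "\<lambda>t. \<Sum>p\<in>P. c p * kernel_at (x p) t"
  let ?w = "\<lambda>h. \<Sum>p\<in>P. cnj (c p) * wave s h (x p)"
  have bd: "norm (?w h) \<le> (\<Sum>p\<in>P. cmod (c p))" for h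
    by (rule order.trans[OF norm_sum]) (simp add: norm_mult)
  have "of_real ((ip_norm ip ?g)\<^sup>2) = ip ?g ?g"
    using assms by (subst ip_self) (auto intro: kernel_sum_mem)
  also have "\<dots> = (\<Sum>q\<in>P. \<Sum>p\<in>P. cnj (c q) * c p * korobov_kernel s \<alpha> (product_weights \<gamma>) (x q) (x p))"
    using assms by (rule ip_self_kernel_sum)
  also have "\<dots> = (\<Sum>q\<in>P. \<Sum>p\<in>P. \<Sum>\<^sub>\<infinity>h\<in>frequencies s.
        of_real (\<rho> h) * ((cnj (c q) * wave s h (x q)) * cnj (cnj (c p) * wave s h (x p))))"
    unfolding kernel_expansion infsum_cmult_right'[symmetric]
    by (simp add: mult_ac)
  also have "\<dots> = (\<Sum>\<^sub>\<infinity>h\<in>frequencies s. \<Sum>q\<in>P. \<Sum>p\<in>P.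
        of_real (\<rho> h) * ((cnj (c q) * wave s h (x q)) * cnj (cnj (c p) * wave s h (x p))))"
  proof -
    have "(\<lambda>h. of_real (\<rho> h) * ((cnj (c q) * wave s h (x q)) * cnj (cnj (c p) * wave s h (x p))))
        summable_on frequencies s" for p q
      by (rule \<rho>_mult_summable[where C = "cmod (c q) * cmod (c p)"]) (simp add: norm_mult)
    thus ?thesis using assms(1)
      by (simp only: infsum_finite_sum summable_on_finite_sum)
  qed
  also have "\<dots> = (\<Sum>\<^sub>\<infinity>h\<in>frequencies s. of_real (\<rho> h * (cmod (?w h))\<^sup>2))"
  proof (intro infsum_cong)
    fix h
    define a where "a p = cnj (c p) * wave s h (x p)" for p
    have eq: "of_real ((cmod (sum a P))\<^sup>2) = (\<Sum>q\<in>P. \<Sum>p\<in>P. a q * cnj (a p))"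
      by (simp only: complex_norm_square cnj_sum sum_product)
    show "(\<Sum>q\<in>P. \<Sum>p\<in>P. of_real (\<rho> h) * ((cnj (c q) * wave s h (x q)) * cnj (cnj (c p) * wave s h (x p))))
        = of_real (\<rho> h * (cmod (?w h))\<^sup>2)"
      unfolding a_def[symmetric] by (simp only: eq of_real_mult sum_distrib_left)
  qed
  also have "\<dots> = of_real (\<Sum>\<^sub>\<infinity>h\<in>frequencies s. \<rho> h * (cmod (?w h))\<^sup>2)"
  proof -
    have "(\<lambda>h. \<rho> h * (cmod (?w h))\<^sup>2) summable_on frequencies s"
      using bd by (intro \<rho>_mult_summable_real[of _ "(\<Sum>p\<in>P. cmod (c p))\<^sup>2"]) (auto intro: power_mono)
    thus ?thesis using has_sum_of_real[OF has_sum_infsum] infsumI by blast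
  qed
  finally show ?thesis by (simp only: of_real_eq_iff)
qed

lemma kernel_sum_eval:
  fixes c :: "'p \<Rightarrow> complex"
  assumes "finite P" "t \<in> unit_cube s"
  shows "(\<Sum>p\<in>P. c p * kernel_at (x p) t)
    = (\<Sum>\<^sub>\<infinity>h\<in>frequencies s. of_real (\<rho> h) * (wave s h t * cnj (\<Sum>p\<in>P. cnj (c p) * wave s h (x p))))"
proof -
  have "(\<lambda>h. of_real (\<rho> h) * (c p * (wave s h t * cnj (wave s h (x p))))) summable_on frequencies s" for p
    by (rule \<rho>_mult_summable[where C = "cmod (c p)"]) (simp add: norm_mult)
  moreover have "(\<Sum>p\<in>P. c p * kernel_at (x p) t)
      = (\<Sum>p\<in>P. \<Sum>\<^sub>\<infinity>h\<in>frequencies s. of_real (\<rho> h) * (c p * (wave s h t * cnj (wave s h (x p)))))"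
    using assms(2)
    by (simp add: kernel_section_def kernel_expansion flip: infsum_cmult_right')
       (simp add: mult_ac)
  ultimately show ?thesis using assms(1)
    by (simp add: infsum_finite_sum[symmetric] sum_distrib_left mult_ac)
qed

text \<open>The difference is one kernel sum over the disjoint union of the index sets, with negated
  coefficients on the second part.\<close>

lemma ip_norm_kernel_sum_diff:
  fixes c :: "'p \<Rightarrow> complex" and d :: "'q \<Rightarrow> complex"
  assumes "finite P" "\<And>p. p \<in> P \<Longrightarrow> x p \<in> unit_cube s"
    and "finite Q" "\<And>q. q \<in> Q \<Longrightarrow> y q \<in> unit_cube s"
  shows "(ip_norm ip (\<lambda>t. (\<Sum>p\<in>P. c p * kernel_at (x p) t) - (\<Sum>q\<in>Q. d q * kernel_at (y q) t)))\<^sup>2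
    = (\<Sum>\<^sub>\<infinity>h\<in>frequencies s. \<rho> h *
        (cmod ((\<Sum>p\<in>P. cnj (c p) * wave s h (x p)) - (\<Sum>q\<in>Q. cnj (d q) * wave s h (y q))))\<^sup>2)"
proof -
  have "finite (P <+> Q)" "\<And>p. p \<in> P <+> Q \<Longrightarrow> case_sum x y p \<in> unit_cube s"
    using assms by (auto split: sum.splits)
  from ip_norm_kernel_sum[where x = "case_sum x y" and P = "P <+> Q", OF this, where c = "case_sum c (\<lambda>q. - d q)"] show ?thesis
    using assms by (simp add: sum.Plus sum_negf)
qed

lemma ip_norm_kernel_at: "x \<in> unit_cube s \<Longrightarrow> (ip_norm ip (kernel_at x))\<^sup>2 = infsum \<rho> (frequencies s)"
  using ip_norm_kernel_sum[of "{()}" "\<lambda>_. x" "\<lambda>_. 1"] by simp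

lemma ip_norm_kernel_at_diff:
  "x \<in> unit_cube s \<Longrightarrow> y \<in> unit_cube s \<Longrightarrow>
    (ip_norm ip (\<lambda>t. kernel_at x t - kernel_at y t))\<^sup>2
    = (\<Sum>\<^sub>\<infinity>h\<in>frequencies s. \<rho> h * (cmod (wave s h x - wave s h y))\<^sup>2)"
  using ip_norm_kernel_sum_diff[of "{()}" "\<lambda>_. x" "{()}" "\<lambda>_. y" "\<lambda>_. 1" "\<lambda>_. 1"] by simp

text \<open>All kernel sections have the same norm because waves have modulus 1, so evaluation is
  bounded uniformly on the cube. Norm limits are therefore pointwise limits, and the integral gets
  its dominating constant.\<close>

lemma norm_le_on_cube:
  assumes "f \<in> H" "x \<in> unit_cube s"
  shows "cmod (f x) \<le> ip_norm ip f * sqrt (infsum \<rho> (frequencies s))"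
proof -
  note K = kernel_mem[OF assms(2)]
  have "sqrt (infsum \<rho> (frequencies s)) = ip_norm ip (kernel_at x)"
    unfolding ip_norm_kernel_at[OF assms(2), symmetric] by (rule real_sqrt_unique[OF refl ip_norm_nonneg[OF K]])
  thus ?thesis
    using Cauchy_Schwarz[OF assms(1) K] reproducing[OF assms] by simp
qed

text \<open>The increment of \<open>f\<close> is its inner product with a difference of kernel
  sections, whose norm tends to 0 by dominated convergence over the frequencies. The sequential,
  coordinatewise form fits the step functions used for the integral.\<close>

lemma tendsto_on_cube:
  assumes f: "f \<in> H" and x: "x \<in> unit_cube s" and y: "\<And>n. y n \<in> unit_cube s"
    and lim: "\<And>j. j \<in> {1..s} \<Longrightarrow> (\<lambda>n. y n j) \<longlonglongrightarrow> x j"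
  shows "(\<lambda>n. f (y n)) \<longlonglongrightarrow> f x"
proof -
  let ?D = "\<lambda>n. \<Sum>\<^sub>\<infinity>h\<in>frequencies s. \<rho> h * (cmod (wave s h (y n) - wave s h x))\<^sup>2"
  have "?D \<longlonglongrightarrow> 0"
  proof (rule infsum_dominated_tendsto_0[where C = 4])
    fix n h
    have "cmod (wave s h (y n) - wave s h x) \<le> 2"
      using norm_triangle_ineq4[of "wave s h (y n)" "wave s h x"] by simp
    hence "(cmod (wave s h (y n) - wave s h x))\<^sup>2 \<le> 2\<^sup>2" by (intro power_mono) auto
    thus "\<bar>(cmod (wave s h (y n) - wave s h x))\<^sup>2\<bar> \<le> 4" by simp
  next
    fix h
    have "(\<lambda>n. wave s h (y n)) \<longlonglongrightarrow> wave s h x"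
      unfolding wave_def by (intro tendsto_intros tendsto_cis lim) auto
    hence "(\<lambda>n. (cmod (wave s h (y n) - wave s h x))\<^sup>2) \<longlonglongrightarrow> (cmod (wave s h x - wave s h x))\<^sup>2"
      by (intro tendsto_intros)
    thus "(\<lambda>n. (cmod (wave s h (y n) - wave s h x))\<^sup>2) \<longlonglongrightarrow> 0" by simp
  qed (use \<rho>_summable \<rho>_nonneg in auto)
  hence "(\<lambda>n. ip_norm ip f * sqrt (?D n)) \<longlonglongrightarrow> ip_norm ip f * sqrt 0"
    by (intro tendsto_intros)
  hence D0: "(\<lambda>n. ip_norm ip f * sqrt (?D n)) \<longlonglongrightarrow> 0"
    by (simp only: real_sqrt_zero mult_zero_right)
  have "norm (f (y n) - f x) \<le> ip_norm ip f * sqrt (?D n)" for n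
  proof -
    have K: "kernel_at (y n) \<in> H" "kernel_at x \<in> H" using x y by (auto intro: kernel_mem)
    hence D: "(\<lambda>t. kernel_at (y n) t - kernel_at x t) \<in> H" by (rule minus_mem)
    have "f (y n) - f x = ip f (\<lambda>t. kernel_at (y n) t - kernel_at x t)"
      using K f x y by (simp add: ip_diff_right reproducing[symmetric])
    moreover have "sqrt (?D n) = ip_norm ip (\<lambda>t. kernel_at (y n) t - kernel_at x t)"
      unfolding ip_norm_kernel_at_diff[OF y x, symmetric] by (rule real_sqrt_unique[OF refl ip_norm_nonneg[OF D]])
    ultimately show ?thesis using Cauchy_Schwarz[OF f D] by simp
  qed
  hence "\<forall>n. norm (f (y n) - f x) \<le> ip_norm ip f * sqrt (?D n)" by blast
  hence "(\<lambda>n. f (y n) - f x) \<longlonglongrightarrow> 0"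
    by (rule Lim_null_comparison[OF always_eventually D0])
  thus ?thesis by (rule LIM_zero_cancel)
qed

end


section \<open>Integration and the worst-case error\<close>

lemma sum_roots_of_unity:
  assumes "M > 0"
  shows "(\<Sum>n<M. cis (2 * pi * (of_int a * real n / real M))) = (if int M dvd a then of_nat M else 0)"
proof -
  define z where "z = cis (2 * pi * (of_int a / real M))"
  have pow: "cis (2 * pi * (of_int a * real n / real M)) = z ^ n" for n
    unfolding z_def Complex.DeMoivre by (rule arg_cong[of _ _ cis]) (simp add: field_simps)
  have zM: "z ^ M = 1"
    using pow[of M] assms by (simp flip: pow add: cis_multiple_2pi)
  show ?thesis
  proof (cases "int M dvd a")
    case True
    then obtain k where "a = int M * k" by auto
    hence "z = 1" using assms by (simp add: z_def cis_multiple_2pi)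
    thus ?thesis using True by (simp only: pow) simp
  next
    case False
    have "z \<noteq> 1"
    proof
      assume "z = 1"
      hence "cos (2 * pi * (of_int a / real M)) = 1" by (simp add: z_def complex_eq_iff)
      then obtain k :: int where "2 * pi * (of_int a / real M) = of_int k * 2 * pi"
        unfolding cos_one_2pi_int by blast
      hence "real_of_int a = real_of_int (k * int M)" using assms by (simp add: field_simps)
      hence "a = k * int M" by (simp only: of_int_eq_iff)
      thus False using False by simp
    qed
    thus ?thesis using False by (simp only: pow) (simp add: geometric_sum zM)
  qed
qed

definition grid :: "nat \<Rightarrow> nat \<Rightarrow> (nat \<Rightarrow> nat) set" where
  "grid s M = {1..s} \<rightarrow>\<^sub>E {..<M}"

definition grid_point :: "nat \<Rightarrow> nat \<Rightarrow> (nat \<Rightarrow> nat) \<Rightarrow> nat \<Rightarrow> real" where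
  "grid_point s M k = (\<lambda>j\<in>{1..s}. real (k j) / real M)"

lemma finite_grid: "finite (grid s M)"
  unfolding grid_def by (intro finite_PiE) auto

lemma card_grid: "card (grid s M) = M ^ s"
  by (simp add: grid_def card_PiE)

lemma grid_point_in_cube: "k \<in> grid s M \<Longrightarrow> grid_point s M k \<in> unit_cube s"
  by (auto simp: grid_def grid_point_def unit_cube_def PiE_iff divide_le_eq)

text \<open>The sum factors over the coordinates into geometric sums, so a grid mean cannot tell
  frequencies divisible by M from the zero frequency (aliasing).\<close>

lemma sum_wave_grid:
  assumes "M > 0"
  shows "(\<Sum>k\<in>grid s M. wave s h (grid_point s M k)) = of_nat (M ^ s) * of_bool (\<forall>j\<in>{1..s}. int M dvd h j)"
proof -
  have "(\<Sum>k\<in>grid s M. wave s h (grid_point s M k))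
      = (\<Sum>k\<in>grid s M. \<Prod>j\<in>{1..s}. cis (2 * pi * (of_int (h j) * real (k j) / real M)))"
    by (simp add: wave_def grid_point_def cis_conv_exp exp_sum[symmetric] sum_distrib_left)
  also have "\<dots> = (\<Prod>j\<in>{1..s}. \<Sum>n<M. cis (2 * pi * (of_int (h j) * real n / real M)))"
    unfolding grid_def by (subst prod_sum_PiE) auto
  also have "\<dots> = (\<Prod>j\<in>{1..s}. if int M dvd h j then of_nat M else 0)"
    by (simp only: sum_roots_of_unity[OF assms])
  also have "\<dots> = of_nat (M ^ s) * of_bool (\<forall>j\<in>{1..s}. int M dvd h j)"
  proof (cases "\<forall>j\<in>{1..s}. int M dvd h j")
    case False
    hence "(\<Prod>j\<in>{1..s}. if int M dvd h j then of_nat M else 0 :: complex) = 0"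
      by (intro prod_zero) auto
    thus ?thesis using False by simp
  qed simp
  finally show ?thesis .
qed

lemma lattice_point_in_cube: "lattice_point N s \<xi> n \<in> unit_cube s"
  by (auto simp: lattice_point_def unit_cube_def PiE_iff frac_lt_1 less_imp_le)

text \<open>Taking fractional parts changes the phase by an integer number of turns and leaves no
  trace; the remaining phase is linear in n.\<close>

lemma wave_lattice_point:
  "wave s h (lattice_point N s \<xi> n) = cis (2 * pi * (of_int (\<Sum>j\<in>{1..s}. h j * \<xi> j) * real n / real N))"
proof -
  define r where "r j = real n * real_of_int (\<xi> j) / real N" for j
  have "(\<Sum>j\<in>{1..s}. of_int (h j) * lattice_point N s \<xi> n j)
      = (\<Sum>j\<in>{1..s}. of_int (h j) * r j) - of_int (\<Sum>j\<in>{1..s}. h j * \<lfloor>r j\<rfloor>)"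
    by (simp add: lattice_point_def frac_def r_def right_diff_distrib sum_subtractf)
  also have "(\<Sum>j\<in>{1..s}. of_int (h j) * r j) = of_int (\<Sum>j\<in>{1..s}. h j * \<xi> j) * real n / real N"
    by (simp add: r_def sum_distrib_left sum_distrib_right sum_divide_distrib mult_ac)
  finally have "(\<Sum>j\<in>{1..s}. of_int (h j) * lattice_point N s \<xi> n j)
    = of_int (\<Sum>j\<in>{1..s}. h j * \<xi> j) * real n / real N - of_int (\<Sum>j\<in>{1..s}. h j * \<lfloor>r j\<rfloor>)" .
  moreover have "cis (2 * pi * of_int k) = 1" for k
    by (rule cis_multiple_2pi) simp
  ultimately show ?thesis
    unfolding wave_def by (simp only: right_diff_distrib cis_divide[symmetric] div_by_1)
qed

section \<open>Cells of the one-dimensional grid\<close>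

definition grid_interval :: "nat \<Rightarrow> nat \<Rightarrow> real set" where
  "grid_interval M k = (if Suc k = M then {real k / M..1} else {real k / M..<real (Suc k) / M})"

text \<open>\<open>grid_interval\<close> closes the last cell so that the M cells partition the
  closed unit interval; accordingly the minimum sends t = 1, where the floor is M, to the last
  cell.\<close>

definition grid_index :: "nat \<Rightarrow> real \<Rightarrow> nat" where
  "grid_index M t = min (nat \<lfloor>real M * t\<rfloor>) (M - 1)"

lemma grid_interval_measurable [measurable]: "grid_interval M k \<in> sets borel"
  by (auto simp: grid_interval_def)

lemma emeasure_grid_interval: "k < M \<Longrightarrow> emeasure lborel (grid_interval M k) = ennreal (1 / M)"
  by (auto simp: grid_interval_def field_simps)

lemma grid_interval_subset: "k < M \<Longrightarrow> grid_interval M k \<subseteq> {0..1}"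
proof
  fix x assume k: "k < M" and x: "x \<in> grid_interval M k"
  have "real (Suc k) / M \<le> 1" using k by simp
  moreover have "real k / M \<le> x \<and> (x \<le> 1 \<or> x \<le> real (Suc k) / M)"
    using x by (auto simp: grid_interval_def split: if_splits)
  moreover have "0 \<le> real k / M" by simp
  ultimately show "x \<in> {0..1}" unfolding atLeastAtMost_iff by linarith
qed

lemma mem_grid_interval_iff:
  assumes "k < M" "t \<in> {0..1}"
  shows "t \<in> grid_interval M k \<longleftrightarrow> k = grid_index M t"
proof -
  define q where "q = nat \<lfloor>real M * t\<rfloor>"
  have le_q: "k \<le> q \<longleftrightarrow> real k / M \<le> t" for k
    unfolding q_def using assms by (simp add: le_nat_iff le_floor_iff pos_divide_le_eq mult.commute)
  have "t \<in> grid_interval M k \<longleftrightarrow> (if Suc k = M then k \<le> q else k \<le> q \<and> \<not> Suc k \<le> q)"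
    unfolding le_q grid_interval_def using assms(2) by auto
  also have "\<dots> \<longleftrightarrow> k = min q (M - 1)"
    using assms(1) by (auto simp: min_def)
  finally show ?thesis by (simp add: grid_index_def q_def)
qed

lemma grid_index_less: "M > 0 \<Longrightarrow> grid_index M t < M"
  by (simp add: grid_index_def)

lemma grid_index_tendsto:
  assumes "t \<in> {0..1}"
  shows "(\<lambda>n. real (grid_index (Suc n) t) / real (Suc n)) \<longlonglongrightarrow> t"
proof -
  have "norm (real (grid_index (Suc n) t) / real (Suc n) - t) \<le> 1 / real (Suc n)" for n
  proof -
    define k where "k = grid_index (Suc n) t"
    have k: "k < Suc n" unfolding k_def by (rule grid_index_less) simp
    have "t \<in> grid_interval (Suc n) k" using mem_grid_interval_iff[OF k assms] by (simp add: k_def)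
    hence "real k / real (Suc n) \<le> t \<and> t \<le> real (Suc k) / real (Suc n)"
      using k by (auto simp: grid_interval_def split: if_splits)
    moreover have "real (Suc k) / real (Suc n) = real k / real (Suc n) + 1 / real (Suc n)"
      by (simp add: add_divide_distrib)
    ultimately show ?thesis unfolding k_def[symmetric] real_norm_def by linarith
  qed
  hence "(\<lambda>n. real (grid_index (Suc n) t) / real (Suc n) - t) \<longlonglongrightarrow> 0"
    by (intro Lim_null_comparison[OF always_eventually LIMSEQ_inverse_real_of_nat[unfolded inverse_eq_divide]]) blast
  thus ?thesis by (rule LIM_zero_cancel)
qed

section \<open>Grid means, the constant function and the integral\<close>

context korobov_space
begin

text \<open>The representer of the equal-weight rule on the grid with M^s nodes. By aliasing, its
  Fourier coefficients for M > 0 are \<open>\<rho> h\<close> at the frequencies divisible by M and 0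
  elsewhere, so only the constant term survives as M grows.\<close>

definition grid_kernel :: "nat \<Rightarrow> (nat \<Rightarrow> real) \<Rightarrow> complex" where
  "grid_kernel M t = (\<Sum>k\<in>grid s M. 1 / of_nat (M ^ s) * kernel_at (grid_point s M k) t)"

definition unit_function :: "(nat \<Rightarrow> real) \<Rightarrow> complex" where
  "unit_function x = (if x \<in> unit_cube s then 1 else 0)"

text \<open>The indicator of the aliased frequencies: all components on [s] are divisible by M, but
  not all are 0.\<close>

definition grid_gap :: "nat \<Rightarrow> (nat \<Rightarrow> int) \<Rightarrow> real" where
  "grid_gap M h = \<bar>of_bool (\<forall>j\<in>{1..s}. int M dvd h j) - of_bool (\<forall>j\<in>{1..s}. h j = 0)\<bar>"

definition grid_tail :: "nat \<Rightarrow> real" where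
  "grid_tail M = (\<Sum>\<^sub>\<infinity>h\<in>frequencies s. \<rho> h * grid_gap M h)"

lemma grid_gap_le: "\<bar>grid_gap M h\<bar> \<le> 1"
  by (auto simp: grid_gap_def)

lemma grid_gap_summable: "(\<lambda>h. \<rho> h * grid_gap M h) summable_on frequencies s"
  using grid_gap_le by (rule \<rho>_mult_summable_real)

lemma grid_tail_tendsto: "(\<lambda>n. grid_tail (Suc n)) \<longlonglongrightarrow> 0"
  unfolding grid_tail_def
proof (rule infsum_dominated_tendsto_0[where C = 1])
  fix h
  \<comment> \<open>A nonzero component divisible by n + 1 has modulus at least n + 1, more than the
    sum of all |h_j|.\<close>
  have "grid_gap (Suc n) h = 0" if "n \<ge> nat (\<Sum>j\<in>{1..s}. \<bar>h j\<bar>)" for n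
  proof -
    have "h j = 0" if j: "j \<in> {1..s}" and d: "int (Suc n) dvd h j" for j
    proof (rule ccontr)
      assume "h j \<noteq> 0"
      hence "int (Suc n) \<le> \<bar>h j\<bar>" using dvd_imp_le_int[of "h j" "int (Suc n)"] d by simp
      also have "\<bar>h j\<bar> \<le> (\<Sum>j\<in>{1..s}. \<bar>h j\<bar>)" using j by (intro member_le_sum) auto
      finally show False using \<open>n \<ge> _\<close> by linarith
    qed
    hence "(\<forall>j\<in>{1..s}. int (Suc n) dvd h j) \<longleftrightarrow> (\<forall>j\<in>{1..s}. h j = 0)"
      by (metis dvd_0_right)
    thus ?thesis by (simp add: grid_gap_def)
  qed
  thus "(\<lambda>n. grid_gap (Suc n) h) \<longlonglongrightarrow> 0"
    by (intro tendsto_eventually eventually_sequentiallyI) blast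
qed (use \<rho>_summable \<rho>_nonneg grid_gap_le in auto)

lemma grid_mean_wave:
  "M > 0 \<Longrightarrow> (\<Sum>k\<in>grid s M. cnj (1 / of_nat (M ^ s)) * wave s h (grid_point s M k))
    = of_bool (\<forall>j\<in>{1..s}. int M dvd h j)"
  unfolding sum_distrib_left[symmetric] by (simp add: sum_wave_grid)

lemma grid_kernel_mem: "grid_kernel M \<in> H"
  unfolding grid_kernel_def using finite_grid grid_point_in_cube by (rule kernel_sum_mem)

lemma ip_grid_kernel:
  "f \<in> H \<Longrightarrow> ip f (grid_kernel M) = (\<Sum>k\<in>grid s M. f (grid_point s M k)) / of_nat (M ^ s)"
  unfolding grid_kernel_def using finite_grid grid_point_in_cube
  by (subst ip_kernel_sum) (auto simp: sum_divide_distrib)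

text \<open>The two divisibility indicators agree at the zero frequency, and wherever they differ
  one of the two gaps is 1. As the tails vanish, this is the Cauchy property, obtained before any
  limit is known.\<close>

lemma grid_kernel_diff_le:
  assumes "M > 0" "M' > 0"
  shows "(ip_norm ip (\<lambda>t. grid_kernel M t - grid_kernel M' t))\<^sup>2 \<le> grid_tail M + grid_tail M'"
proof -
  have "(ip_norm ip (\<lambda>t. grid_kernel M t - grid_kernel M' t))\<^sup>2 = (\<Sum>\<^sub>\<infinity>h\<in>frequencies s. \<rho> h *
      (cmod (of_bool (\<forall>j\<in>{1..s}. int M dvd h j) - of_bool (\<forall>j\<in>{1..s}. int M' dvd h j)))\<^sup>2)"
    unfolding grid_kernel_def
    by (subst ip_norm_kernel_sum_diff[OF finite_grid grid_point_in_cube finite_grid grid_point_in_cube])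
       (simp_all only: grid_mean_wave assms)
  also have "\<dots> \<le> (\<Sum>\<^sub>\<infinity>h\<in>frequencies s. \<rho> h * grid_gap M h + \<rho> h * grid_gap M' h)"
    unfolding distrib_left[symmetric]
  proof (intro infsum_mono mult_left_mono \<rho>_nonneg \<rho>_mult_summable_real)
    show "\<bar>(cmod (of_bool (\<forall>j\<in>{1..s}. int M dvd h j) - of_bool (\<forall>j\<in>{1..s}. int M' dvd h j)))\<^sup>2\<bar> \<le> 1" for h
      by (auto simp: of_bool_def)
    show "\<bar>grid_gap M h + grid_gap M' h\<bar> \<le> 2" for h
      using grid_gap_le[of M h] grid_gap_le[of M' h] by linarith
    show "(cmod (of_bool (\<forall>j\<in>{1..s}. int M dvd h j) - of_bool (\<forall>j\<in>{1..s}. int M' dvd h j)))\<^sup>2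
        \<le> grid_gap M h + grid_gap M' h" for h
      by (auto simp: of_bool_def grid_gap_def)
  qed
  also have "\<dots> = grid_tail M + grid_tail M'"
    unfolding grid_tail_def by (intro infsum_add grid_gap_summable)
  finally show ?thesis .
qed

lemma zero_frequency:
  defines "z \<equiv> (\<lambda>j\<in>{1..s}. 0 :: int)"
  shows "z \<in> frequencies s" "\<And>h. h \<in> frequencies s \<Longrightarrow> (\<forall>j\<in>{1..s}. h j = 0) \<longleftrightarrow> h = z"
    "\<rho> z = 1" "wave s z x = 1"
  by (auto simp: z_def frequencies_def korobov_coeff_def korobov_factor_def int_powr_def wave_def PiE_iff
      extensional_def fun_eq_iff)

lemma infsum_zero_frequency:
  fixes F :: "(nat \<Rightarrow> int) \<Rightarrow> 'a :: {comm_monoid_add, t2_space}"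
  assumes "\<And>h. h \<in> frequencies s \<Longrightarrow> \<not> (\<forall>j\<in>{1..s}. h j = 0) \<Longrightarrow> F h = 0"
  shows "infsum F (frequencies s) = F (\<lambda>j\<in>{1..s}. 0)"
proof -
  have "infsum F (frequencies s) = infsum F {\<lambda>j\<in>{1..s}. 0}"
  proof (rule infsum_cong_neutral)
    fix h assume "h \<in> frequencies s - {\<lambda>j\<in>{1..s}. 0}"
    thus "F h = 0" using assms[of h] zero_frequency(2)[of h] by blast
  qed (use zero_frequency(1) in auto)
  thus ?thesis by simp
qed

lemma cnj_of_bool: "cnj (of_bool b) = of_bool b"
  by (cases b) auto

text \<open>Completeness provides a limit without a formula; this bound identifies its values on the
  cube. It adds up the moduli of the aliased terms.\<close>

lemma norm_grid_kernel_minus_1: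
  assumes "M > 0" "t \<in> unit_cube s"
  shows "cmod (grid_kernel M t - 1) \<le> grid_tail M"
proof -
  let ?A = "\<lambda>h. of_real (\<rho> h) * (wave s h t * of_bool (\<forall>j\<in>{1..s}. int M dvd h j))"
  let ?B = "\<lambda>h. of_real (\<rho> h) * (wave s h t * of_bool (\<forall>j\<in>{1..s}. h j = 0))"
  have A: "?A summable_on frequencies s" and B: "?B summable_on frequencies s"
    by (rule \<rho>_mult_summable[where C = 1]; simp add: norm_mult)+
  have "grid_kernel M t = infsum ?A (frequencies s)"
    unfolding grid_kernel_def kernel_sum_eval[OF finite_grid assms(2)] grid_mean_wave[OF assms(1)] cnj_of_bool
    by (rule refl)
  moreover have "infsum ?B (frequencies s) = 1"
    by (subst infsum_zero_frequency) (use zero_frequency in auto)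
  ultimately have eq: "grid_kernel M t - 1 = infsum (\<lambda>h. ?A h - ?B h) (frequencies s)"
    using infsum_add[OF A summable_on_uminus[THEN iffD2, OF B]] by (simp add: infsum_uminus)
  have le: "norm (?A h - ?B h) \<le> \<rho> h * grid_gap M h" for h
    using \<rho>_nonneg[of h] by (auto simp: grid_gap_def norm_mult)
  have "norm (infsum (\<lambda>h. ?A h - ?B h) (frequencies s)) \<le> grid_tail M"
    unfolding grid_tail_def
    by (rule norm_infsum_le[OF has_sum_infsum has_sum_infsum[OF grid_gap_summable] le])
       (use summable_on_add[OF A summable_on_uminus[THEN iffD2, OF B]] in simp)
  thus ?thesis by (simp add: eq)
qed

text \<open>Norm convergence forces pointwise convergence, so the limit takes the value 1 on the
  cube; off the cube every member of \<open>H\<close> is 0.\<close>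

lemma unit_function_limit:
  "unit_function \<in> H" "(\<lambda>n. ip_norm ip (\<lambda>x. grid_kernel (Suc n) x - unit_function x)) \<longlonglongrightarrow> 0"
proof -
  let ?A = "\<lambda>n. grid_kernel (Suc n)"
  have "\<exists>f\<in>H. (\<lambda>n. ip_norm ip (\<lambda>x. ?A n x - f x)) \<longlonglongrightarrow> 0"
  proof (rule complete)
    fix \<epsilon> :: real assume "\<epsilon> > 0"
    hence "eventually (\<lambda>n. grid_tail (Suc n) < \<epsilon>\<^sup>2 / 2) sequentially"
      by (intro order_tendstoD[OF grid_tail_tendsto]) auto
    then obtain n0 where n0: "\<And>n. n \<ge> n0 \<Longrightarrow> grid_tail (Suc n) < \<epsilon>\<^sup>2 / 2"
      by (auto simp: eventually_sequentially)
    have "ip_norm ip (\<lambda>x. ?A p x - ?A q x) < \<epsilon>" if "p \<ge> n0" "q \<ge> n0" for p q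
    proof (rule power2_less_imp_less)
      show "(ip_norm ip (\<lambda>x. ?A p x - ?A q x))\<^sup>2 < \<epsilon>\<^sup>2"
        using grid_kernel_diff_le[of "Suc p" "Suc q"] n0[OF that(1)] n0[OF that(2)] by simp
    qed (use \<open>\<epsilon> > 0\<close> in simp)
    thus "\<exists>n0. \<forall>p\<ge>n0. \<forall>q\<ge>n0. ip_norm ip (\<lambda>x. ?A p x - ?A q x) < \<epsilon>" by blast
  qed (rule grid_kernel_mem)
  then obtain f where f: "f \<in> H" "(\<lambda>n. ip_norm ip (\<lambda>x. ?A n x - f x)) \<longlonglongrightarrow> 0" by blast
  have "f t = unit_function t" for t
  proof (cases "t \<in> unit_cube s")
    case True
    define C where "C = sqrt (infsum \<rho> (frequencies s))"
    have le: "cmod (?A n t - f t) \<le> ip_norm ip (\<lambda>x. ?A n x - f x) * C" for n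
      using norm_le_on_cube[OF minus_mem[OF grid_kernel_mem f(1)] True] by (simp add: C_def)
    have lim: "(\<lambda>n. ip_norm ip (\<lambda>x. ?A n x - f x) * C) \<longlonglongrightarrow> 0"
      using tendsto_mult_right[OF f(2), of C] by (simp add: tendsto_mult_left_zero f(2))
    have "(\<lambda>n. ?A n t - f t) \<longlonglongrightarrow> 0"
      by (rule Lim_null_comparison[OF always_eventually lim]) (use le in blast)
    hence "(\<lambda>n. ?A n t) \<longlonglongrightarrow> f t" by (rule LIM_zero_cancel)
    moreover have "(\<lambda>n. ?A n t - 1) \<longlonglongrightarrow> 0"
      by (rule Lim_null_comparison[OF always_eventually grid_tail_tendsto])
         (use norm_grid_kernel_minus_1[OF _ True] in auto)
    hence "(\<lambda>n. ?A n t) \<longlonglongrightarrow> 1" by (rule LIM_zero_cancel)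
    ultimately show ?thesis using True LIMSEQ_unique by (auto simp: unit_function_def)
  next
    case False
    thus ?thesis using supp[OF f(1)] by (simp add: unit_function_def)
  qed
  hence "f = unit_function" by blast
  thus "unit_function \<in> H" "(\<lambda>n. ip_norm ip (\<lambda>x. ?A n x - unit_function x)) \<longlonglongrightarrow> 0"
    using f by simp_all
qed

lemma grid_mean_tendsto:
  assumes f: "f \<in> H"
  shows "(\<lambda>n. (\<Sum>k\<in>grid s (Suc n). f (grid_point s (Suc n) k)) / of_nat (Suc n ^ s)) \<longlonglongrightarrow> ip f unit_function"
proof -
  let ?A = "\<lambda>n. grid_kernel (Suc n)"
  have lim: "(\<lambda>n. ip_norm ip f * ip_norm ip (\<lambda>x. ?A n x - unit_function x)) \<longlonglongrightarrow> 0"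
    using tendsto_mult_right_zero[OF unit_function_limit(2)] by blast
  have "cmod (ip f (?A n) - ip f unit_function) \<le> ip_norm ip f * ip_norm ip (\<lambda>x. ?A n x - unit_function x)" for n
    using Cauchy_Schwarz[OF f minus_mem[OF grid_kernel_mem unit_function_limit(1)]]
    by (simp add: ip_diff_right f grid_kernel_mem unit_function_limit(1))
  hence "(\<lambda>n. ip f (?A n) - ip f unit_function) \<longlonglongrightarrow> 0"
    by (intro Lim_null_comparison[OF always_eventually lim]) blast
  hence "(\<lambda>n. ip f (?A n)) \<longlonglongrightarrow> ip f unit_function" by (rule LIM_zero_cancel)
  thus ?thesis by (simp only: ip_grid_kernel[OF f])
qed

lemma ip_unit_function_self: "ip unit_function unit_function = 1"
proof -
  have "(\<Sum>k\<in>grid s (Suc n). unit_function (grid_point s (Suc n) k)) / of_nat (Suc n ^ s) = 1" for n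
    using grid_point_in_cube by (simp add: unit_function_def card_grid del: of_nat_Suc)
  with grid_mean_tendsto[OF unit_function_limit(1)] show ?thesis
    by (simp only: LIMSEQ_const_iff)
qed

text \<open>On each cell \<open>F n\<close> takes the value of \<open>f\<close> at the lower corner.
  On the cube these step functions converge to \<open>f\<close> by continuity and stay below the
  constant \<open>C\<close>, so their integrals, which are the grid means, converge to the integral
  of \<open>f\<close>; the same means converge to the inner product. The pointwise limit also yields
  the measurability of the integrand.\<close>

lemma integral_eq_ip_unit_function:
  assumes f: "f \<in> H"
  shows "(LINT x:unit_cube s|(\<Pi>\<^sub>M j\<in>{1..s}. lborel). f x) = ip f unit_function"
proof -
  interpret product_sigma_finite "\<lambda>_ :: nat. lborel :: real measure" by standard
  define P where "P = (\<Pi>\<^sub>M j\<in>{1..s}. (lborel :: real measure))"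
  define cell where "cell M k = Pi\<^sub>E {1..s} (\<lambda>j. grid_interval M (k j))" for M and k :: "nat \<Rightarrow> nat"
  define F where "F n x = (\<Sum>k\<in>grid s (Suc n). indicator (cell (Suc n) k) x *\<^sub>R f (grid_point s (Suc n) k))" for n x
  define C where "C = ip_norm ip f * sqrt (infsum \<rho> (frequencies s))"
  have C: "C \<ge> 0" unfolding C_def
    using f by (intro mult_nonneg_nonneg ip_norm_nonneg) (auto intro: infsum_nonneg \<rho>_nonneg)
  have cell_sets: "cell M k \<in> sets P" for M k
    unfolding cell_def P_def by (intro sets_PiM_I_finite) auto
  have cube_sets: "unit_cube s \<in> sets P"
    unfolding unit_cube_def P_def by (intro sets_PiM_I_finite) auto
  have cell_measure: "emeasure P (cell M k) = ennreal ((1 / M) ^ s)" if "k \<in> grid s M" for M k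
  proof -
    have "emeasure P (cell M k) = (\<Prod>j\<in>{1..s}. emeasure lborel (grid_interval M (k j)))"
      unfolding P_def cell_def by (intro emeasure_PiM) auto
    also have "\<dots> = (\<Prod>j\<in>{1..s}. ennreal (1 / M))"
      using that by (intro prod.cong refl emeasure_grid_interval) (auto simp: grid_def)
    finally show ?thesis by (simp add: ennreal_power)
  qed
  have cube_finite: "emeasure P (unit_cube s) < \<infinity>"
    unfolding unit_cube_def P_def by (subst emeasure_PiM) auto
  have F_eq: "F n x = f (grid_point s (Suc n) (\<lambda>j\<in>{1..s}. grid_index (Suc n) (x j)))"
    if "x \<in> unit_cube s" for n x
  proof -
    let ?k = "\<lambda>j\<in>{1..s}. grid_index (Suc n) (x j)"
    have "?k \<in> grid s (Suc n)" by (auto simp: grid_def grid_index_less)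
    moreover have "x \<in> cell (Suc n) k \<longleftrightarrow> k = ?k" if k: "k \<in> grid s (Suc n)" for k
    proof -
      have "x \<in> cell (Suc n) k \<longleftrightarrow> (\<forall>j\<in>{1..s}. x j \<in> grid_interval (Suc n) (k j))"
        using \<open>x \<in> unit_cube s\<close> by (auto simp: cell_def unit_cube_def PiE_iff)
      also have "\<dots> \<longleftrightarrow> (\<forall>j\<in>{1..s}. k j = grid_index (Suc n) (x j))"
        using \<open>x \<in> unit_cube s\<close> k
        by (intro ball_cong refl mem_grid_interval_iff) (auto simp: unit_cube_def grid_def PiE_iff)
      also have "\<dots> \<longleftrightarrow> k = ?k"
        using k by (auto simp: grid_def PiE_iff extensional_def fun_eq_iff)
      finally show ?thesis .
    qed
    hence "F n x = (\<Sum>k\<in>grid s (Suc n). if k = ?k then f (grid_point s (Suc n) k) else 0)"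
      unfolding F_def by (intro sum.cong) (auto simp: indicator_def)
    ultimately show ?thesis using finite_grid by (simp add: sum.delta)
  qed
  have F_0: "F n x = 0" if "x \<notin> unit_cube s" for n x
  proof -
    have "cell (Suc n) k \<subseteq> unit_cube s" if "k \<in> grid s (Suc n)" for k
      unfolding cell_def unit_cube_def using that
      by (intro PiE_mono grid_interval_subset) (auto simp: grid_def)
    thus ?thesis using that unfolding F_def by (intro sum.neutral) (auto simp: indicator_def)
  qed
  let ?f = "\<lambda>x. indicat_real (unit_cube s) x *\<^sub>R f x"
  have lim: "(\<lambda>n. F n x) \<longlonglongrightarrow> ?f x" for x
  proof (cases "x \<in> unit_cube s")
    case True
    have "(\<lambda>n. f (grid_point s (Suc n) (\<lambda>j\<in>{1..s}. grid_index (Suc n) (x j)))) \<longlonglongrightarrow> f x"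
    proof (rule tendsto_on_cube[OF f True])
      show "grid_point s (Suc n) (\<lambda>j\<in>{1..s}. grid_index (Suc n) (x j)) \<in> unit_cube s" for n
        by (rule grid_point_in_cube) (auto simp: grid_def grid_index_less)
      fix j assume j: "j \<in> {1..s}"
      have "x j \<in> {0..1}" using True j by (auto simp: unit_cube_def)
      thus "(\<lambda>n. grid_point s (Suc n) (\<lambda>j\<in>{1..s}. grid_index (Suc n) (x j)) j) \<longlonglongrightarrow> x j"
        using j grid_index_tendsto[of "x j"] by (simp add: grid_point_def)
    qed
    thus ?thesis using True F_eq by simp
  qed (simp add: F_0)
  have F_meas: "F n \<in> borel_measurable P" for n
    unfolding F_def using cell_sets by (intro borel_measurable_sum borel_measurable_scaleR borel_measurable_indicator) auto
  have "(\<lambda>n. integral\<^sup>L P (F n)) \<longlonglongrightarrow> integral\<^sup>L P ?f"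
  proof (rule integral_dominated_convergence[where w = "\<lambda>x. C * indicator (unit_cube s) x"])
    show "?f \<in> borel_measurable P"
      using F_meas lim by (rule borel_measurable_LIMSEQ_metric)
    show "integrable P (\<lambda>x. C * indicat_real (unit_cube s) x)"
      using cube_sets cube_finite by (intro integrable_mult_right) simp
    show "AE x in P. norm (F n x) \<le> C * indicator (unit_cube s) x" for n
    proof (rule AE_I2)
      fix x
      show "norm (F n x) \<le> C * indicator (unit_cube s) x"
      proof (cases "x \<in> unit_cube s")
        case True
        have "grid_point s (Suc n) (\<lambda>j\<in>{1..s}. grid_index (Suc n) (x j)) \<in> unit_cube s"
          by (rule grid_point_in_cube) (auto simp: grid_def grid_index_less)
        thus ?thesis using True norm_le_on_cube[OF f] by (simp add: F_eq C_def)
      qed (simp add: F_0)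
    qed
  qed (use F_meas lim in auto)
  moreover have "integral\<^sup>L P (F n) = (\<Sum>k\<in>grid s (Suc n). f (grid_point s (Suc n) k)) / of_nat (Suc n ^ s)" for n
  proof -
    have fin: "emeasure P (cell (Suc n) k) < \<infinity>" if "k \<in> grid s (Suc n)" for k
      using cell_measure[OF that] by simp
    have meas: "measure P (cell (Suc n) k) = (1 / real (Suc n)) ^ s" if "k \<in> grid s (Suc n)" for k
      using cell_measure[OF that] by (simp add: measure_def del: of_nat_Suc)
    have "integral\<^sup>L P (F n) = (\<Sum>k\<in>grid s (Suc n). measure P (cell (Suc n) k) *\<^sub>R f (grid_point s (Suc n) k))"
      unfolding F_def using fin cell_sets
      by (subst Bochner_Integration.integral_sum) (auto intro!: sum.cong)
    also have "\<dots> = (\<Sum>k\<in>grid s (Suc n). (1 / real (Suc n)) ^ s *\<^sub>R f (grid_point s (Suc n) k))"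
      by (intro sum.cong refl) (simp only: meas)
    also have "\<dots> = (\<Sum>k\<in>grid s (Suc n). f (grid_point s (Suc n) k)) / of_nat (Suc n ^ s)"
      by (simp add: scaleR_conv_of_real sum_divide_distrib power_divide del: of_nat_Suc)
    finally show ?thesis .
  qed
  ultimately have "integral\<^sup>L P ?f = ip f unit_function"
    using LIMSEQ_unique grid_mean_tendsto[OF f] by simp
  thus ?thesis unfolding set_lebesgue_integral_def P_def .
qed

text \<open>The congruence enters as a factor 0 or 1, so that sums for different generating vectors
  run over the same index set and can be compared term by term.\<close>

definition dual_weight :: "nat \<Rightarrow> (nat \<Rightarrow> int) \<Rightarrow> (nat \<Rightarrow> int) \<Rightarrow> real" where
  "dual_weight N \<xi> h = \<rho> h * of_bool (int N dvd (\<Sum>j\<in>{1..s}. h j * \<xi> j))"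

text \<open>The representer of the error is \<open>g\<close>, the constant 1 minus the representer
  \<open>L\<close> of the lattice rule. The inner products of 1 with itself and with
  \<open>L\<close> are 1, so the squared norm of \<open>g\<close> is that of \<open>L\<close> minus
  1, and this 1 is the term of the zero frequency. The second claim allows taking square roots
  afterwards.\<close>

lemma worst_case_error_squared:
  assumes N: "N > 0"
  shows "(worst_case_error H ip N s \<xi>)\<^sup>2 = infsum (dual_weight N \<xi>) (frequencies s) - 1"
    and "worst_case_error H ip N s \<xi> \<ge> 0"
proof -
  let ?u = unit_function
  define L where "L = (\<lambda>t. \<Sum>n<N. 1 / of_nat N * kernel_at (lattice_point N s \<xi> n) t)"
  define g where "g = (\<lambda>t. ?u t - L t)"
  have u: "?u \<in> H" by (rule unit_function_limit)
  have L: "L \<in> H" unfolding L_def by (intro kernel_sum_mem lattice_point_in_cube) simp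
  have g: "g \<in> H" unfolding g_def using u L by (rule minus_mem)
  have ip_L: "ip f L = (\<Sum>n<N. f (lattice_point N s \<xi> n)) / of_nat N" if "f \<in> H" for f
    unfolding L_def using that
    by (subst ip_kernel_sum) (auto simp: lattice_point_in_cube sum_divide_distrib)
  have "integration_error N s \<xi> f = ip f g" if "f \<in> H" for f
    unfolding integration_error_def integral_eq_ip_unit_function[OF that] g_def
    using that u L by (simp add: ip_diff_right ip_L)
  hence "worst_case_error H ip N s \<xi> = (SUP f\<in>{f \<in> H. ip_norm ip f \<le> 1}. cmod (ip f g))"
    unfolding worst_case_error_def by (intro SUP_cong) auto
  hence wce: "worst_case_error H ip N s \<xi> = ip_norm ip g"
    using SUP_unit_ball_functional[OF g] by simp
  thus "worst_case_error H ip N s \<xi> \<ge> 0" using ip_norm_nonneg[OF g] by simp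
  have uL: "ip ?u L = 1" using N by (simp add: ip_L u unit_function_def lattice_point_in_cube)
  hence Lu: "ip L ?u = 1" using ip_cnj[OF u L] by simp
  have "ip g g = ip L L - 1"
    unfolding g_def using u L minus_mem[OF u L]
    by (simp add: ip_diff ip_diff_right uL Lu ip_unit_function_self)
  hence "(ip_norm ip g)\<^sup>2 = (ip_norm ip L)\<^sup>2 - 1"
    using ip_self[OF g] ip_self[OF L] by (metis (no_types, lifting) of_real_1 of_real_diff of_real_eq_iff)
  also have "(ip_norm ip L)\<^sup>2 = infsum (dual_weight N \<xi>) (frequencies s)"
  proof -
    have "(ip_norm ip L)\<^sup>2 = (\<Sum>\<^sub>\<infinity>h\<in>frequencies s. \<rho> h *
        (cmod (\<Sum>n<N. cnj (1 / of_nat N) * wave s h (lattice_point N s \<xi> n)))\<^sup>2)"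
      unfolding L_def by (rule ip_norm_kernel_sum) (auto simp: lattice_point_in_cube)
    also have "\<dots> = infsum (dual_weight N \<xi>) (frequencies s)"
    proof (rule infsum_cong)
      fix h
      have "(\<Sum>n<N. cnj (1 / of_nat N) * wave s h (lattice_point N s \<xi> n))
          = of_bool (int N dvd (\<Sum>j\<in>{1..s}. h j * \<xi> j))"
        unfolding sum_distrib_left[symmetric] wave_lattice_point sum_roots_of_unity[OF N]
        using N by simp
      thus "\<rho> h * (cmod (\<Sum>n<N. cnj (1 / of_nat N) * wave s h (lattice_point N s \<xi> n)))\<^sup>2
          = dual_weight N \<xi> h"
        unfolding dual_weight_def by (simp only: of_bool_def split: if_split) simp
    qed
    finally show ?thesis .
  qed
  finally show "(worst_case_error H ip N s \<xi>)\<^sup>2 = infsum (dual_weight N \<xi>) (frequencies s) - 1"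
    by (simp only: wce)
qed

end


section \<open>The steps of the search\<close>

text \<open>After division by the total \<open>T\<close> the terms add up to 1 and lie in [0,1],
  where x <= x^l.\<close>

lemma powr_sum_le_sum_powr:
  fixes f :: "'a \<Rightarrow> real"
  assumes "finite S" "\<And>x. x \<in> S \<Longrightarrow> f x \<ge> 0" "0 < l" "l \<le> 1"
  shows "(\<Sum>x\<in>S. f x) powr l \<le> (\<Sum>x\<in>S. f x powr l)"
proof (cases "sum f S = 0")
  case True
  thus ?thesis by (simp add: sum_nonneg)
next
  case False
  define T where "T = sum f S"
  have T: "T > 0" using False assms(2) by (simp add: T_def less_le sum_nonneg)
  have "T powr l = T powr l * (\<Sum>x\<in>S. f x / T)"
    using T by (simp add: T_def flip: sum_divide_distrib)
  also have "\<dots> \<le> T powr l * (\<Sum>x\<in>S. (f x / T) powr l)"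
  proof (intro mult_left_mono sum_mono)
    fix x assume x: "x \<in> S"
    have "f x \<le> T" unfolding T_def using assms x by (intro member_le_sum) auto
    hence "(f x / T) powr 1 \<le> (f x / T) powr l"
      using T assms x by (intro powr_mono') auto
    thus "f x / T \<le> (f x / T) powr l" using T assms(2)[OF x] by simp
  qed simp
  also have "\<dots> = (\<Sum>x\<in>S. f x powr l)"
    using T assms(2) by (simp add: sum_distrib_left powr_divide)
  finally show ?thesis by (simp add: T_def)
qed

lemma sum_PiE_insert:
  assumes "d \<notin> J"
  shows "(\<Sum>h\<in>insert d J \<rightarrow>\<^sub>E T. G h) = (\<Sum>g\<in>J \<rightarrow>\<^sub>E T. \<Sum>a\<in>T. G (g(d := a)))"
proof -
  have "(\<Sum>h\<in>insert d J \<rightarrow>\<^sub>E T. G h) = (\<Sum>(a, g)\<in>T \<times> (J \<rightarrow>\<^sub>E T). G (g(d := a)))"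
    unfolding PiE_insert_eq using inj_combinator[OF assms, of "\<lambda>_. T"]
    by (subst sum.reindex) (auto simp: case_prod_unfold)
  also have "\<dots> = (\<Sum>a\<in>T. \<Sum>g\<in>J \<rightarrow>\<^sub>E T. G (g(d := a)))"
    by (rule sum.cartesian_product[symmetric])
  finally show ?thesis by (simp only: sum.swap[of _ "J \<rightarrow>\<^sub>E T"])
qed

text \<open>At most one summand of the factor is nonzero, so the power passes inside. The powers of
  \<open>\<rho>\<close> are thus coefficients of the same shape with parameters \<alpha> l and
  \<gamma>_j^l, and the estimates above apply to them when \<alpha> l > 1.\<close>

lemma korobov_factor_powr:
  assumes "g \<ge> 0"
  shows "korobov_factor \<alpha> g a powr l = korobov_factor (\<alpha> * l) (g powr l) a"
  using assms by (cases "a = 0")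
    (simp_all add: korobov_factor_def powr_mult int_powr_powr int_powr_nonneg, simp add: int_powr_def)

lemma korobov_coeff_powr:
  assumes "\<And>j. j \<in> {1..s} \<Longrightarrow> \<gamma> j \<ge> 0"
  shows "korobov_coeff s \<alpha> \<gamma> h powr l = korobov_coeff s (\<alpha> * l) (\<lambda>j. \<gamma> j powr l) h"
  unfolding korobov_coeff_def using assms
  by (subst prod_powr_distrib) (auto simp: korobov_factor_powr korobov_factor_nonneg intro!: prod.cong)

context korobov_space
begin

text \<open>This is \<theta>_d, taken for an arbitrary generating vector
  \<open>\<xi>\<close>.\<close>

definition dual_part :: "nat \<Rightarrow> nat \<Rightarrow> (nat \<Rightarrow> int) \<Rightarrow> real" where
  "dual_part N d \<xi> = (\<Sum>\<^sub>\<infinity>h\<in>frequencies s. dual_weight N \<xi> h * of_bool (h d \<noteq> 0))"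

lemma dual_weight_nonneg: "dual_weight N \<xi> h \<ge> 0"
  by (simp add: dual_weight_def \<rho>_nonneg)

lemma dual_weight_summable: "(\<lambda>h. dual_weight N \<xi> h * of_bool (Q h)) summable_on frequencies s"
  unfolding dual_weight_def mult.assoc
  by (rule \<rho>_mult_summable_real[where C = 1]) simp

lemma dual_part_nonneg: "dual_part N d \<xi> \<ge> 0"
  unfolding dual_part_def by (intro infsum_nonneg mult_nonneg_nonneg dual_weight_nonneg) auto

lemma infsum_dual_weight_split:
  "infsum (dual_weight N \<xi>) (frequencies s) =
    (\<Sum>\<^sub>\<infinity>h\<in>frequencies s. dual_weight N \<xi> h * of_bool (\<not> Q h))
    + (\<Sum>\<^sub>\<infinity>h\<in>frequencies s. dual_weight N \<xi> h * of_bool (Q h))"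
  by (subst infsum_add[symmetric, OF dual_weight_summable dual_weight_summable])
     (auto intro!: infsum_cong)

text \<open>The frequencies with \<open>h d = 0\<close> do not see component \<open>d\<close>, so
  their part is common to both sides and cancels. The search criterion becomes a comparison of
  \<open>dual_part\<close>.\<close>

lemma dual_part_le_iff:
  assumes "\<And>j. j \<in> {1..s} - {d} \<Longrightarrow> \<xi> j = \<eta> j"
  shows "dual_part N d \<xi> \<le> dual_part N d \<eta> \<longleftrightarrow>
    infsum (dual_weight N \<xi>) (frequencies s) \<le> infsum (dual_weight N \<eta>) (frequencies s)"
proof -
  have "(\<Sum>j\<in>{1..s}. h j * \<xi> j) = (\<Sum>j\<in>{1..s}. h j * \<eta> j)" if "h d = 0" for h :: "nat \<Rightarrow> int"
  proof (rule sum.cong)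
    show "h j * \<xi> j = h j * \<eta> j" if "j \<in> {1..s}" for j
      using assms[of j] \<open>h d = 0\<close> that by (cases "j = d") auto
  qed simp
  hence eq: "dual_weight N \<xi> h * of_bool (\<not> h d \<noteq> 0) = dual_weight N \<eta> h * of_bool (\<not> h d \<noteq> 0)" for h
    by (simp add: dual_weight_def)
  thus ?thesis
    unfolding dual_part_def infsum_dual_weight_split[of N \<xi> "\<lambda>h. h d \<noteq> 0"]
      infsum_dual_weight_split[of N \<eta> "\<lambda>h. h d \<noteq> 0"]
    by (simp only: eq add_le_cancel_left)
qed

text \<open>A finite \<open>F\<close> can be enlarged to a box, where sums may be exchanged freely.
  With the components g of h other than h_d fixed, the sum over t and h_d is a weighted count of
  solutions with shift \<open>c g\<close>; its bound is independent of g, and what remains factors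
  over the other coordinates.\<close>

lemma sum_dual_weight_powr_le:
  fixes \<eta> :: "int \<Rightarrow> nat \<Rightarrow> int" and m :: nat
  assumes b: "prime b" and d: "d \<in> {1..s}" and l: "0 < l" "\<alpha> * l > 1"
    and \<eta>: "\<And>t j. j \<in> {1..s} - {d} \<Longrightarrow> \<eta> t j = \<xi> j" "\<And>t. \<eta> t d = int b ^ v * t"
    and F: "finite F" "F \<subseteq> frequencies s"
  defines "Z \<equiv> search_space b m v" and "q \<equiv> zeta_real (\<alpha> * l)"
  shows "(\<Sum>t\<in>Z. \<Sum>h\<in>F. (dual_weight (b ^ m) (\<eta> t) h * of_bool (h d \<noteq> 0)) powr l)
    \<le> card Z * (\<gamma> d powr l * real b ^ v * (4 * q) / real b ^ m * (\<Prod>j\<in>{1..s} - {d}. 1 + \<gamma> j powr l * (2 * q)))"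
proof -
  define J where "J = {1..s} - {d}"
  have J: "finite J" "d \<notin> J" "{1..s} = insert d J" using d by (auto simp: J_def)
  define \<kappa> where "\<kappa> j = korobov_factor (\<alpha> * l) (\<gamma> j powr l)" for j
  have \<kappa>: "\<kappa> j a \<ge> 0" for j a by (simp add: \<kappa>_def korobov_factor_nonneg)
  have finZ: "finite Z" unfolding Z_def by (rule finite_search_space)
  have q: "q > 0" unfolding q_def using l by (intro zeta_real_pos)
  obtain T where T: "finite T" "F \<subseteq> {1..s} \<rightarrow>\<^sub>E T" using finite_subset_frequencies[OF F] by blast
  define c where "c g = (\<Sum>j\<in>J. g j * \<xi> j)" for g :: "nat \<Rightarrow> int"
  have card_Z: "(\<Sum>t\<in>Z. of_bool (Q t)) = real (card {t\<in>Z. Q t})" for Q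
    using finZ by (simp add: Int_def)
  have summand: "(dual_weight (b ^ m) (\<eta> t) (g(d := a)) * of_bool ((g(d := a)) d \<noteq> 0)) powr l =
      (\<Prod>j\<in>J. \<kappa> j (g j)) * (\<gamma> d powr l * (int_powr (\<alpha> * l) a * of_bool (int b ^ m dvd int b ^ v * t * a + c g)))"
    for g t a
  proof -
    have "(\<Sum>j\<in>{1..s}. (g(d := a)) j * \<eta> t j) = int b ^ v * t * a + c g"
    proof -
      have "(\<Sum>j\<in>J. (g(d := a)) j * \<eta> t j) = c g"
        unfolding c_def using J \<eta>(1) by (intro sum.cong) (auto simp: J_def)
      thus ?thesis using J(1,2) unfolding J(3) by (simp add: \<eta>(2))
    qed
    moreover have "\<rho> (g(d := a)) powr l * of_bool (a \<noteq> 0) =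
        (\<Prod>j\<in>J. \<kappa> j (g j)) * (\<gamma> d powr l * int_powr (\<alpha> * l) a)"
    proof -
      have "(\<Prod>j\<in>J. \<kappa> j ((g(d := a)) j)) = (\<Prod>j\<in>J. \<kappa> j (g j))"
        using J by (intro prod.cong) auto
      moreover have "\<rho> (g(d := a)) powr l = (\<Prod>j\<in>insert d J. \<kappa> j ((g(d := a)) j))"
        using korobov_coeff_powr[of s \<gamma> \<alpha> "g(d := a)" l, OF \<gamma>]
        unfolding korobov_coeff_def \<kappa>_def J(3)[symmetric] by blast
      ultimately have "\<rho> (g(d := a)) powr l = \<kappa> d a * (\<Prod>j\<in>J. \<kappa> j (g j))"
        using J(1,2) by simp
      moreover have "\<kappa> d a * of_bool (a \<noteq> 0) = \<gamma> d powr l * int_powr (\<alpha> * l) a"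
        by (simp add: \<kappa>_def korobov_factor_def int_powr_def)
      ultimately show ?thesis by (simp add: mult_ac)
    qed
    ultimately show ?thesis using l(1) by (auto simp: dual_weight_def)
  qed
  have "(\<Sum>t\<in>Z. \<Sum>h\<in>F. (dual_weight (b ^ m) (\<eta> t) h * of_bool (h d \<noteq> 0)) powr l)
      \<le> (\<Sum>t\<in>Z. \<Sum>h\<in>insert d J \<rightarrow>\<^sub>E T. (dual_weight (b ^ m) (\<eta> t) h * of_bool (h d \<noteq> 0)) powr l)"
    using T J by (intro sum_mono sum_mono2) (auto intro!: finite_PiE)
  also have "\<dots> = (\<Sum>t\<in>Z. \<Sum>g\<in>J \<rightarrow>\<^sub>E T. \<Sum>a\<in>T. (\<Prod>j\<in>J. \<kappa> j (g j)) *
      (\<gamma> d powr l * (int_powr (\<alpha> * l) a * of_bool (int b ^ m dvd int b ^ v * t * a + c g))))"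
    by (simp only: sum_PiE_insert[OF J(2)] summand)
  also have "\<dots> = (\<Sum>g\<in>J \<rightarrow>\<^sub>E T. \<Sum>a\<in>T. \<Sum>t\<in>Z. (\<Prod>j\<in>J. \<kappa> j (g j)) *
      (\<gamma> d powr l * (int_powr (\<alpha> * l) a * of_bool (int b ^ m dvd int b ^ v * t * a + c g))))"
    by (rule trans[OF sum.swap sum.cong[OF refl sum.swap]])
  also have "\<dots> = (\<Sum>g\<in>J \<rightarrow>\<^sub>E T. (\<Prod>j\<in>J. \<kappa> j (g j)) * (\<gamma> d powr l *
      (\<Sum>a\<in>T. int_powr (\<alpha> * l) a * card {t\<in>Z. int b ^ m dvd int b ^ v * t * a + c g})))"
    by (simp only: sum_distrib_left[symmetric] card_Z)
  also have "\<dots> \<le> (\<Sum>g\<in>J \<rightarrow>\<^sub>E T. (\<Prod>j\<in>J. \<kappa> j (g j)) * (\<gamma> d powr l *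
      (card Z * (4 * q * real b ^ v / real b ^ m))))"
    unfolding Z_def q_def using b l T(1) \<kappa>
    by (intro sum_mono mult_left_mono sum_int_powr_count_le prod_nonneg) auto
  also have "\<dots> = (\<Prod>j\<in>J. \<Sum>a\<in>T. \<kappa> j a) * (\<gamma> d powr l * (card Z * (4 * q * real b ^ v / real b ^ m)))"
    unfolding sum_distrib_right[symmetric] using J(1) T(1) by (subst prod_sum_PiE) auto
  also have "\<dots> \<le> (\<Prod>j\<in>J. 1 + \<gamma> j powr l * (2 * q)) * (\<gamma> d powr l * (card Z * (4 * q * real b ^ v / real b ^ m)))"
    using q l T(1) unfolding q_def \<kappa>_def
    by (intro mult_right_mono prod_mono conjI sum_nonneg korobov_factor_nonneg sum_korobov_factor_le) auto
  finally show ?thesis by (simp add: J_def mult_ac)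
qed

text \<open>The minimum is at most the mean over the search space. The bound on the mean is proved
  for finite partial sums and passes to the limit by continuity of \<open>powr\<close>, so
  subadditivity is applied to finite sums only.\<close>

lemma minimal_dual_part_powr_le:
  fixes \<eta> :: "int \<Rightarrow> nat \<Rightarrow> int" and m :: nat
  assumes b: "prime b" and d: "d \<in> {1..s}" and l: "0 < l" "l \<le> 1" "\<alpha> * l > 1"
    and \<eta>: "\<And>t j. j \<in> {1..s} - {d} \<Longrightarrow> \<eta> t j = \<xi> j" "\<And>t. \<eta> t d = int b ^ v * t"
    and t0: "t0 \<in> search_space b m v"
    and min: "\<And>t. t \<in> search_space b m v \<Longrightarrow> dual_part (b ^ m) d (\<eta> t0) \<le> dual_part (b ^ m) d (\<eta> t)"
  defines "q \<equiv> zeta_real (\<alpha> * l)"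
  shows "dual_part (b ^ m) d (\<eta> t0) powr l
    \<le> \<gamma> d powr l * real b ^ v * (4 * q) / real b ^ m * (\<Prod>j\<in>{1..s} - {d}. 1 + \<gamma> j powr l * (2 * q))"
    (is "_ \<le> ?B")
proof -
  define Z where "Z = search_space b m v"
  have finZ: "finite Z" unfolding Z_def by (rule finite_search_space)
  let ?W = "\<lambda>t h. dual_weight (b ^ m) (\<eta> t) h * of_bool (h d \<noteq> 0)"
  have W0: "?W t h \<ge> 0" for t h by (simp add: dual_weight_nonneg)
  have "card Z * dual_part (b ^ m) d (\<eta> t0) powr l = (\<Sum>t\<in>Z. dual_part (b ^ m) d (\<eta> t0) powr l)"
    by simp
  also have "\<dots> \<le> (\<Sum>t\<in>Z. dual_part (b ^ m) d (\<eta> t) powr l)"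
    using l min by (intro sum_mono powr_mono2 dual_part_nonneg) (auto simp: Z_def)
  also have "\<dots> \<le> card Z * ?B"
  proof (rule tendsto_upperbound)
    show "((\<lambda>F. \<Sum>t\<in>Z. (\<Sum>h\<in>F. ?W t h) powr l) \<longlongrightarrow> (\<Sum>t\<in>Z. dual_part (b ^ m) d (\<eta> t) powr l))
        (finite_subsets_at_top (frequencies s))"
      unfolding dual_part_def using l(1)
      by (intro tendsto_sum tendsto_powr' infsum_tendsto dual_weight_summable tendsto_const)
         (auto intro!: sum_nonneg W0)
    show "eventually (\<lambda>F. (\<Sum>t\<in>Z. (\<Sum>h\<in>F. ?W t h) powr l) \<le> card Z * ?B) (finite_subsets_at_top (frequencies s))"
    proof (rule eventually_finite_subsets_at_top_weakI)
      fix F assume F: "finite F" "F \<subseteq> frequencies s"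
      have "(\<Sum>t\<in>Z. (\<Sum>h\<in>F. ?W t h) powr l) \<le> (\<Sum>t\<in>Z. \<Sum>h\<in>F. ?W t h powr l)"
        using F l by (intro sum_mono powr_sum_le_sum_powr W0) auto
      also have "\<dots> \<le> card Z * ?B"
        unfolding Z_def q_def using b d l(1,3) \<eta> F by (rule sum_dual_weight_powr_le)
      finally show "(\<Sum>t\<in>Z. (\<Sum>h\<in>F. ?W t h) powr l) \<le> card Z * ?B" .
    qed
  qed simp
  finally have "card Z * dual_part (b ^ m) d (\<eta> t0) powr l \<le> card Z * ?B" .
  moreover have "real (card Z) > 0" using t0 finZ by (auto simp: Z_def card_gt_0_iff)
  ultimately show ?thesis by (rule mult_left_le_imp_le)
qed

end


section \<open>The error bound\<close>

context korobov_space
begin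

lemma infsum_dual_weight_minus_1:
  "infsum (dual_weight N \<xi>) (frequencies s) - 1 =
    (\<Sum>\<^sub>\<infinity>h\<in>frequencies s. dual_weight N \<xi> h * of_bool (\<exists>j\<in>{1..s}. h j \<noteq> 0))"
proof -
  have "(\<Sum>\<^sub>\<infinity>h\<in>frequencies s. dual_weight N \<xi> h * of_bool (\<not> (\<exists>j\<in>{1..s}. h j \<noteq> 0))) = 1"
    by (subst infsum_zero_frequency) (use zero_frequency in \<open>auto simp: dual_weight_def\<close>)
  thus ?thesis
    using infsum_dual_weight_split[of N \<xi> "\<lambda>h. \<exists>j\<in>{1..s}. h j \<noteq> 0"] by linarith
qed

lemma infsum_dual_weight_le_sum_dual_part:
  fixes \<eta> :: "nat \<Rightarrow> nat \<Rightarrow> int"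
  assumes "\<And>d j. d \<in> {1..s} \<Longrightarrow> 1 \<le> j \<Longrightarrow> j \<le> d \<Longrightarrow> \<eta> d j = \<xi> j"
  shows "infsum (dual_weight N \<xi>) (frequencies s) - 1 \<le> (\<Sum>d\<in>{1..s}. dual_part N d (\<eta> d))"
proof -
  let ?f = "\<lambda>d h. dual_weight N (\<eta> d) h * of_bool (h d \<noteq> 0)"
  have "dual_weight N \<xi> h * of_bool (\<exists>j\<in>{1..s}. h j \<noteq> 0) \<le> (\<Sum>d\<in>{1..s}. ?f d h)" for h
  proof (cases "\<exists>j\<in>{1..s}. h j \<noteq> 0")
    case True
    \<comment> \<open>Only coordinates up to the largest index \<open>d\<close> in the support of \<open>h\<close> enter the congruence,
      and these already have their final values in step \<open>d\<close>.\<close>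
    define d where "d = Max {j\<in>{1..s}. h j \<noteq> 0}"
    have "d \<in> {j\<in>{1..s}. h j \<noteq> 0}" unfolding d_def using True by (intro Max_in) auto
    hence d: "d \<in> {1..s}" "h d \<noteq> 0" by auto
    have "h j = 0" if "j \<in> {1..s}" "j > d" for j
    proof (rule ccontr)
      assume "h j \<noteq> 0"
      hence "j \<le> d" unfolding d_def using that(1) by (intro Max_ge) auto
      thus False using that(2) by simp
    qed
    hence "h j * \<xi> j = h j * \<eta> d j" if "j \<in> {1..s}" for j
      using assms[OF d(1), of j] that by (cases "j \<le> d") auto
    hence "(\<Sum>j\<in>{1..s}. h j * \<xi> j) = (\<Sum>j\<in>{1..s}. h j * \<eta> d j)"
      by (rule sum.cong[OF refl])
    hence "dual_weight N \<xi> h * of_bool (\<exists>j\<in>{1..s}. h j \<noteq> 0) = ?f d h"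
      using True d by (simp add: dual_weight_def)
    also have "\<dots> \<le> (\<Sum>d\<in>{1..s}. ?f d h)"
      using d by (intro member_le_sum) (auto simp: dual_weight_nonneg)
    finally show ?thesis .
  qed (simp add: sum_nonneg dual_weight_nonneg)
  hence "infsum (dual_weight N \<xi>) (frequencies s) - 1 \<le> (\<Sum>\<^sub>\<infinity>h\<in>frequencies s. \<Sum>d\<in>{1..s}. ?f d h)"
    unfolding infsum_dual_weight_minus_1
    by (intro infsum_mono dual_weight_summable summable_on_finite_sum) auto
  also have "\<dots> = (\<Sum>d\<in>{1..s}. dual_part N d (\<eta> d))"
    unfolding dual_part_def by (intro infsum_finite_sum dual_weight_summable) auto
  finally show ?thesis .
qed

end

text \<open>Factor \<open>d\<close> takes the place of factor \<open>s\<close> and is at least as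
  large. For non-increasing weights this gives one common product for all steps, although step d
  omits its own index.\<close>

lemma prod_remove_le_prod_remove_last:
  fixes p :: "nat \<Rightarrow> real"
  assumes "d \<in> {1..s}" "\<And>j. j \<in> {1..s} \<Longrightarrow> p j \<ge> 0" "p s \<le> p d"
  shows "(\<Prod>j\<in>{1..s} - {d}. p j) \<le> (\<Prod>j\<in>{1..s-1}. p j)"
proof (cases "d = s")
  case True
  hence "{1..s} - {d} = {1..s-1}" using assms(1) by auto
  thus ?thesis by simp
next
  case False
  define J where "J = {1..s} - {d, s}"
  have "{1..s} - {d} = insert s J" "{1..s-1} = insert d J"
    using False assms(1) by (auto simp: J_def)
  moreover have "finite J" "s \<notin> J" "d \<notin> J" by (auto simp: J_def)
  moreover have "(\<Prod>j\<in>J. p j) \<ge> 0" using assms(2) by (intro prod_nonneg) (auto simp: J_def)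
  ultimately show ?thesis using assms(3) by (simp add: mult_right_mono)
qed

context korobov_space
begin

lemma reduced_scs_error_bound:
  fixes m :: nat
  assumes b: "prime b" and s: "s \<ge> 1" and N: "N = b ^ m"
    and anti: "\<And>j. j \<in> {1..s} \<Longrightarrow> \<gamma> s \<le> \<gamma> j"
    and scs: "reduced_scs (worst_case_error H ip N s) b m w s z0 z"
    and \<delta>: "\<delta> \<in> {0<..(\<alpha> - 1) / 2}"
  shows "worst_case_error H ip N s (scs_output b w s z)
    \<le> scs_const b w s \<alpha> \<gamma> \<delta> * real N powr (- \<alpha> / 2 + \<delta>)"
proof -
  define l where "l = 1 / (\<alpha> - 2 * \<delta>)"
  have a: "\<alpha> - 2 * \<delta> \<ge> 1" using \<delta> by auto
  have l: "0 < l" "l \<le> 1" "\<alpha> * l > 1" using a \<delta> by (auto simp: l_def)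
  define q where "q = zeta_real (\<alpha> * l)"
  have q: "q > 0" unfolding q_def using l by (intro zeta_real_pos)
  have b0: "b > 0" using b prime_gt_0_nat by auto
  hence N0: "N > 0" using N by simp
  define \<eta> where "\<eta> d t = (\<lambda>j\<in>{1..s}. if j < d then int b ^ w j * z j
                           else if j = d then int b ^ w d * t else z0 j)" for d t
  let ?out = "scs_output b w s z"
  let ?e = "worst_case_error H ip N s"
  let ?p = "\<lambda>j. 1 + \<gamma> j powr l * (2 * q)"
  define P where "P = (\<Prod>j\<in>{1..s-1}. ?p j)"
  have step: "dual_part N d (\<eta> d (z d)) powr l \<le> \<gamma> d powr l * real b ^ w d * (4 * q) * P / N"
    if d: "d \<in> {1..s}" for d
  proof -
    have am: "is_arg_min (\<lambda>t. (?e (\<eta> d t))\<^sup>2) (\<lambda>t. t \<in> search_space b m (w d)) (z d)"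
      using scs d unfolding reduced_scs_def \<eta>_def by blast
    have "dual_part (b ^ m) d (\<eta> d (z d)) powr l
        \<le> \<gamma> d powr l * real b ^ w d * (4 * zeta_real (\<alpha> * l)) / real b ^ m *
          (\<Prod>j\<in>{1..s} - {d}. 1 + \<gamma> j powr l * (2 * zeta_real (\<alpha> * l)))"
    \<comment> \<open>\<open>\<eta> d 0\<close> only supplies the components other than d; the value
      0 is a placeholder.\<close>
    proof (rule minimal_dual_part_powr_le[OF b d l, where \<xi> = "\<eta> d 0"])
      show "z d \<in> search_space b m (w d)" using am by (simp add: is_arg_min_def)
      fix t assume "t \<in> search_space b m (w d)"
      hence "(?e (\<eta> d (z d)))\<^sup>2 \<le> (?e (\<eta> d t))\<^sup>2"
        using am by (auto simp: is_arg_min_def not_less)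
      hence "infsum (dual_weight N (\<eta> d (z d))) (frequencies s) \<le> infsum (dual_weight N (\<eta> d t)) (frequencies s)"
        by (simp add: worst_case_error_squared(1)[OF N0])
      thus "dual_part (b ^ m) d (\<eta> d (z d)) \<le> dual_part (b ^ m) d (\<eta> d t)"
        unfolding N[symmetric] by (subst dual_part_le_iff) (auto simp: \<eta>_def)
    qed (use d in \<open>auto simp: \<eta>_def\<close>)
    also have "\<dots> \<le> \<gamma> d powr l * real b ^ w d * (4 * q) / real b ^ m * P"
      unfolding q_def[symmetric] P_def
    proof (intro mult_left_mono prod_remove_le_prod_remove_last d)
      show "1 + \<gamma> s powr l * (2 * q) \<le> 1 + \<gamma> d powr l * (2 * q)"
        using anti[OF d] \<gamma>[of s] s l q by (intro add_left_mono mult_right_mono powr_mono2) auto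
    qed (use q in auto)
    finally show ?thesis by (simp add: N)
  qed
  define E where "E = (?e ?out)\<^sup>2"
  define S where "S = (\<Sum>d=1..s. \<gamma> d powr l * real b ^ w d) * (4 * q) * P"
  have S0: "S \<ge> 0" unfolding S_def P_def using q
    by (intro mult_nonneg_nonneg sum_nonneg prod_nonneg) auto
  have "E \<le> (\<Sum>d\<in>{1..s}. dual_part N d (\<eta> d (z d)))"
    unfolding E_def worst_case_error_squared(1)[OF N0]
    by (rule infsum_dual_weight_le_sum_dual_part) (auto simp: \<eta>_def scs_output_def)
  hence "E powr l \<le> (\<Sum>d\<in>{1..s}. dual_part N d (\<eta> d (z d))) powr l"
    using l by (intro powr_mono2) (auto simp: E_def)
  also have "\<dots> \<le> (\<Sum>d\<in>{1..s}. dual_part N d (\<eta> d (z d)) powr l)"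
    using l by (intro powr_sum_le_sum_powr dual_part_nonneg) auto
  also have "\<dots> \<le> (\<Sum>d\<in>{1..s}. \<gamma> d powr l * real b ^ w d * (4 * q) * P / N)"
    by (intro sum_mono step)
  also have "\<dots> = S / N"
    by (simp add: S_def sum_distrib_right sum_divide_distrib)
  finally have El: "E powr l \<le> S / N" .
  \<comment> \<open>The exponents match: the power \<alpha>/2 - \<delta> of E^l is the square root
    of E, which is the error itself.\<close>
  have r: "l * (\<alpha> / 2 - \<delta>) = 1 / 2" using a by (simp add: l_def field_simps)
  have "?e ?out = sqrt E"
    using worst_case_error_squared(2)[OF N0] by (simp add: E_def)
  also have "\<dots> = (E powr l) powr (\<alpha> / 2 - \<delta>)"
    unfolding powr_powr r by (rule powr_half_sqrt[symmetric]) (simp add: E_def)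
  also have "\<dots> \<le> (S / N) powr (\<alpha> / 2 - \<delta>)"
    using El a by (intro powr_mono2) auto
  also have "\<dots> = S powr (\<alpha> / 2 - \<delta>) * real N powr (- \<alpha> / 2 + \<delta>)"
    using S0 N0 powr_minus_divide[of "real N" "\<alpha> / 2 - \<delta>"] by (simp add: powr_divide)
  also have "S powr (\<alpha> / 2 - \<delta>) = scs_const b w s \<alpha> \<gamma> \<delta>"
    by (simp add: S_def P_def scs_const_def q_def l_def)
  finally show ?thesis .
qed

end

text \<open>By 1 + x <= exp x and b^w >= 1 the product is at most the exponential of a multiple of
  the series that bounds the sum, so the value \<open>A\<close> of that series controls
  both.\<close>

lemma scs_const_bounded:
  assumes b: "b > 0" and \<alpha>: "\<alpha> > 1" and \<delta>: "\<delta> \<in> {0<..(\<alpha> - 1) / 2}"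
    and sum: "summable (\<lambda>d. \<gamma> (Suc d) powr (1 / (\<alpha> - 2 * \<delta>)) * real b ^ w (Suc d))"
  shows "\<exists>B. \<forall>s. \<bar>scs_const b w s \<alpha> \<gamma> \<delta>\<bar> \<le> B"
proof -
  define l where "l = 1 / (\<alpha> - 2 * \<delta>)"
  have a: "\<alpha> - 2 * \<delta> \<ge> 1" using \<delta> by auto
  have l: "0 < l" "\<alpha> / (\<alpha> - 2 * \<delta>) > 1" using a \<delta> by (auto simp: l_def)
  define q where "q = zeta_real (\<alpha> / (\<alpha> - 2 * \<delta>))"
  have q: "q > 0" unfolding q_def using l by (intro zeta_real_pos)
  define A where "A = (\<Sum>d. \<gamma> (Suc d) powr l * real b ^ w (Suc d))"
  have sums: "(\<Sum>d=1..s. \<gamma> d powr l * real b ^ w d) \<le> A" for s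
  proof -
    have "(\<Sum>d=1..s. \<gamma> d powr l * real b ^ w d) = (\<Sum>d<s. \<gamma> (Suc d) powr l * real b ^ w (Suc d))"
      by (rule sum.reindex_bij_witness[of _ Suc "\<lambda>d. d - 1"]) auto
    also have "\<dots> \<le> A"
      unfolding A_def using sum by (intro sum_le_suminf) (auto simp: l_def)
    finally show ?thesis .
  qed
  have A0: "A \<ge> 0" using sums[of 0] by simp
  have prods: "(\<Prod>d=1..s. 1 + \<gamma> d powr l * (2 * q)) \<le> exp (A * (2 * q))" for s
  proof -
    have "(\<Prod>d=1..s. 1 + \<gamma> d powr l * (2 * q)) \<le> exp (\<Sum>d=1..s. \<gamma> d powr l * (2 * q))"
      using q by (intro prod_le_exp_sum) auto
    also have "\<dots> \<le> exp (\<Sum>d=1..s. \<gamma> d powr l * real b ^ w d * (2 * q))"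
    proof (subst exp_le_cancel_iff, intro sum_mono mult_right_mono)
      fix d
      show "\<gamma> d powr l \<le> \<gamma> d powr l * real b ^ w d"
        using b mult_left_mono[of 1 "real b ^ w d" "\<gamma> d powr l"] by simp
    qed (use q in simp)
    also have "\<dots> \<le> exp (A * (2 * q))"
      using sums[of s] q by (simp add: sum_distrib_right[symmetric])
    finally show ?thesis .
  qed
  have "\<bar>scs_const b w s \<alpha> \<gamma> \<delta>\<bar> \<le> (A * (4 * q) * exp (A * (2 * q))) powr (\<alpha> / 2 - \<delta>)" for s
    unfolding scs_const_def l_def[symmetric] q_def[symmetric] abs_of_nonneg[OF powr_ge_zero]
    using sums[of s] prods[of "s - 1"] q A0 a
    by (intro powr_mono2 mult_mono mult_nonneg_nonneg sum_nonneg prod_nonneg) auto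
  thus ?thesis by blast
qed

theorem corollary3:
  fixes b m N :: nat and \<alpha> :: real and \<gamma> :: "nat \<Rightarrow> real" and w :: "nat \<Rightarrow> nat"
  assumes "prime b" and "m \<ge> 1" and "N = b ^ m" and "\<alpha> > 1"
    and "\<And>j. j \<ge> 1 \<Longrightarrow> \<gamma> j > 0" and "antimono_on {1..} \<gamma>"
    and "mono_on {1..} w"
  shows "(\<forall>s\<ge>1. \<forall>H ip z0 z.
            rkhs (unit_cube s) (korobov_kernel s \<alpha> (product_weights \<gamma>)) H ip \<longrightarrow>
            z0 \<in> {1..s} \<rightarrow>\<^sub>E {0..int N - 1} \<longrightarrow>
            reduced_scs (worst_case_error H ip N s) b m w s z0 z \<longrightarrow>
            (\<forall>\<delta>\<in>{0<..(\<alpha> - 1) / 2}.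
               worst_case_error H ip N s (scs_output b w s z)
                 \<le> scs_const b w s \<alpha> \<gamma> \<delta> * real N powr (- \<alpha> / 2 + \<delta>)))
       \<and> (\<forall>\<delta>\<in>{0<..(\<alpha> - 1) / 2}.
            summable (\<lambda>d. \<gamma> (Suc d) powr (1 / (\<alpha> - 2 * \<delta>)) * real b ^ w (Suc d)) \<longrightarrow>
            (\<exists>B. \<forall>s\<ge>1. \<bar>scs_const b w s \<alpha> \<gamma> \<delta>\<bar> \<le> B))"
proof (intro conjI allI ballI impI)
  fix s :: nat and H ip z0 z \<delta>
  assume s: "s \<ge> 1" and "rkhs (unit_cube s) (korobov_kernel s \<alpha> (product_weights \<gamma>)) H ip"
    and scs: "reduced_scs (worst_case_error H ip N s) b m w s z0 z"
    and \<delta>: "\<delta> \<in> {0<..(\<alpha> - 1) / 2}"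
  then interpret rkhs "unit_cube s" "korobov_kernel s \<alpha> (product_weights \<gamma>)" H ip by simp
  interpret korobov_space s \<alpha> \<gamma> H ip
    using assms(4,5) by unfold_locales (auto simp: less_imp_le)
  have "\<gamma> s \<le> \<gamma> j" if "j \<in> {1..s}" for j
    using monotone_onD[OF assms(6), of j s] that by simp
  with assms(1) s assms(3)
  show "worst_case_error H ip N s (scs_output b w s z)
      \<le> scs_const b w s \<alpha> \<gamma> \<delta> * real N powr (- \<alpha> / 2 + \<delta>)"
    using scs \<delta> by (rule reduced_scs_error_bound)
next
  fix \<delta>
  assume "\<delta> \<in> {0<..(\<alpha> - 1) / 2}"
    and "summable (\<lambda>d. \<gamma> (Suc d) powr (1 / (\<alpha> - 2 * \<delta>)) * real b ^ w (Suc d))"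
  from scs_const_bounded[OF prime_gt_0_nat[OF assms(1)] assms(4) this]
  show "\<exists>B. \<forall>s\<ge>1. \<bar>scs_const b w s \<alpha> \<gamma> \<delta>\<bar> \<le> B" by blast
qed

end
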